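(* Let $\mathcal{A}(\lambda)=A_0+\sum_{i=1}^m\lambda_iA_i$ with $A_i\in\mathbb{C}^{k\times\ell}$, $k=\ell+m-1$, define a rectangular multiparameter eigenvalue problem, let $(\lambda^*,x^* )$ be an eigenpair with $\lambda^*$ an algebraically simple eigenvalue, let $E_0,\dots,E_m\in\mathbb{C}^{k\times\ell}$ be given error matrices, and let $g\in\mathbb{C}^\ell$ be a constant vector with $g^Hx^*=1$. Let $V\in\mathbb{C}^{\ell\times(\ell-1)}$ and $W\in\mathbb{C}^{k\times(\ell-1)}$ be full column rank matrices with $g^HV=0$ and $W^HA_ix^*=0$ for $i=1,\dots,m$. Then the norm-wise relative eigenvector condition number of $x^*$ is $$\kappa(x^* )=\big\|V\big(W^H\mathcal{A}(\lambda^* )V\big)^{-1}W^H\big\|_2\,\gamma^*,\qquad \gamma^*=\|E_0\|_2+\sum_{i=1}^m|\lambda_i^*|\,\|E_i\|_2.$$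
   Context: $\|\cdot\|_2$ denotes the Euclidean norm of vectors and the induced (spectral) norm of matrices; $(\cdot)^H$ is the conjugate transpose. Rectangular multiparameter eigenvalue problem: $A_0,\dots,A_m\in\mathbb{C}^{k\times\ell}$, $k=\ell+m-1$, are such that $\mathcal{A}(\lambda)=A_0+\sum_{i=1}^m\lambda_iA_i$ has full normal rank (rank $\ell$ at a generic $\lambda\in\mathbb{C}^m$). An eigenpair is $(\lambda^*,x^* )\in\mathbb{C}^m\times(\mathbb{C}^\ell\setminus\{0\})$ with $\mathcal{A}(\lambda^* )x^*=0$. Secular equations: for the $L=\binom{k}{\ell}$ selections $\sigma_1,\dots,\sigma_L$ of $\ell$ out of $k$ rows, $\chi_i(\lambda)=\det[\mathcal{A}(\lambda)]_{\sigma_i}$, the determinant of the submatrix formed by the rows in $\sigma_i$. An eigenvalue $\lambda^*$ is algebraically simple if it is a simple common root of $\chi_1,\dots,\chi_L$, i.e. the $L\times m$ Jacobian $(\partial\chi_i/\partial\lambda_j)(\lambda^* )$ has full rank $m$. The norm-wise relative eigenvector condition number is $$\kappa(x^* )=\lim_{\epsilon\to0}\sup\frac{\|\Delta x\|_2}{\epsilon\|x^*\|_2},$$ the supremum being over all perturbations satisfying $$\Big(A_0+\Delta A_0+\sum_{i=1}^m(\lambda_i^*+\Delta\lambda_i)(A_i+\Delta A_i)\Big)(x^*+\Delta x)=0,\qquad \|\Delta A_i\|_2\le\epsilon\|E_i\|_2,\ i=0,\dots,m,\qquad g^Hx^*=g^H(x^*+\Delta x)=1,$$ with $\Delta A_i\in\mathbb{C}^{k\times\ell}$,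 $\Delta\lambda\in\mathbb{C}^m$, $\Delta x\in\mathbb{C}^\ell$, where $(\lambda^*+\Delta\lambda,x^*+\Delta x)$ is the perturbed eigenpair on the local branch through $(\lambda^*,x^* )$, i.e. $\Delta\lambda\to0$ and $\Delta x\to0$ as $\epsilon\to0$. *)

theory Defs
  imports "HOL-Analysis.Analysis" "Jordan_Normal_Form.DL_Rank" "Jordan_Normal_Form.DL_Submatrix"
    "Jordan_Normal_Form.Schur_Decomposition"
begin

no_notation Finite_Cartesian_Product.vec_nth (infixl "$" 90)
hide_const (open) Finite_Cartesian_Product.vec Finite_Cartesian_Product.mat

definition vnorm :: "complex vec \<Rightarrow> real" where
  "vnorm v = L2_set (\<lambda>i. cmod (v $ i)) {..<dim_vec v}"

text \<open>The supremum is over the closed unit ball rather than the unit sphere, so that it is also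
  taken over a nonempty set for a matrix without columns.\<close>

definition spectral_norm :: "complex mat \<Rightarrow> real" where
  "spectral_norm A = (SUP v \<in> {v \<in> carrier_vec (dim_col A). vnorm v \<le> 1}. vnorm (A *\<^sub>v v))"

text \<open>The coefficients are a family \<open>A 0, \<dots>, A m\<close>, and a point of $\mathbb{C}^m$ is a function
  of which only the values at the indices \<open>1, \<dots>, m\<close> matter.\<close>

definition pencil :: "nat \<Rightarrow> nat \<Rightarrow> nat \<Rightarrow> (nat \<Rightarrow> complex mat) \<Rightarrow> (nat \<Rightarrow> complex) \<Rightarrow> complex mat" where
  "pencil k l m A lam = mat k l (\<lambda>(r, c). A 0 $$ (r, c) + (\<Sum>i = 1..m. lam i * A i $$ (r, c)))"

definition normal_rank :: "nat \<Rightarrow> nat \<Rightarrow> nat \<Rightarrow> (nat \<Rightarrow> complex mat) \<Rightarrow> nat" where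
  "normal_rank k l m A = Max (range (\<lambda>lam. vec_space.rank k (pencil k l m A lam)))"

definition rect_mep :: "nat \<Rightarrow> nat \<Rightarrow> nat \<Rightarrow> (nat \<Rightarrow> complex mat) \<Rightarrow> bool" where
  "rect_mep k l m A \<longleftrightarrow> 1 \<le> l \<and> 1 \<le> m \<and> k = l + m - 1 \<and>
     (\<forall>i \<le> m. A i \<in> carrier_mat k l) \<and> normal_rank k l m A = l"

definition eigenpair ::
  "nat \<Rightarrow> nat \<Rightarrow> nat \<Rightarrow> (nat \<Rightarrow> complex mat) \<Rightarrow> (nat \<Rightarrow> complex) \<Rightarrow> complex vec \<Rightarrow> bool" where
  "eigenpair k l m A lam x \<longleftrightarrow>
     x \<in> carrier_vec l \<and> x \<noteq> 0\<^sub>v l \<and> pencil k l m A lam *\<^sub>v x = 0\<^sub>v k"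

definition row_selections :: "nat \<Rightarrow> nat \<Rightarrow> nat set list" where
  "row_selections k l = filter (\<lambda>s. card s = l) (map set (subseqs [0..<k]))"

lemma set_row_selections: "set (row_selections k l) = {s. s \<subseteq> {..<k} \<and> card s = l}"
proof -
  have "set (map set (subseqs [0..<k])) = Pow {..<k}"
    using subseqs_powset[of "[0..<k]"] by (simp add: atLeast0LessThan)
  then show ?thesis unfolding row_selections_def set_filter by auto
qed

lemma distinct_row_selections: "distinct (row_selections k l)"
  by (simp add: row_selections_def distinct_set_subseqs)

lemma length_row_selections: "length (row_selections k l) = k choose l"
  using n_subsets[of "{..<k}" l] distinct_card[OF distinct_row_selections[of k l]]
  by (simp add: set_row_selections)

definition secular ::
  "nat \<Rightarrow> nat \<Rightarrow> nat \<Rightarrow> (nat \<Rightarrow> complex mat) \<Rightarrow> nat set \<Rightarrow> (nat \<Rightarrow> complex) \<Rightarrow> complex" where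
  "secular k l m A s lam = Determinant.det (submatrix (pencil k l m A lam) s UNIV)"

definition secular_jacobian ::
  "nat \<Rightarrow> nat \<Rightarrow> nat \<Rightarrow> (nat \<Rightarrow> complex mat) \<Rightarrow> (nat \<Rightarrow> complex) \<Rightarrow> complex mat" where
  "secular_jacobian k l m A lam = mat (length (row_selections k l)) m
     (\<lambda>(i, j). deriv (\<lambda>t. secular k l m A (row_selections k l ! i) (lam(Suc j := t))) (lam (Suc j)))"

definition algebraically_simple ::
  "nat \<Rightarrow> nat \<Rightarrow> nat \<Rightarrow> (nat \<Rightarrow> complex mat) \<Rightarrow> (nat \<Rightarrow> complex) \<Rightarrow> bool" where
  "algebraically_simple k l m A lam \<longleftrightarrow>
     (\<forall>s \<in> set (row_selections k l). secular k l m A s lam = 0) \<and>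
     vec_space.rank (length (row_selections k l)) (secular_jacobian k l m A lam) = m"

text \<open>The eigenvector perturbations \<open>\<Delta>x\<close> admissible at size \<open>\<epsilon>\<close> whose perturbed eigenpair lies in
  the \<open>\<delta>\<close>-neighbourhood of the given one. The product \<open>x \<bullet>c g\<close> is $g^H x$.\<close>

definition eigvec_perturbations ::
  "nat \<Rightarrow> nat \<Rightarrow> nat \<Rightarrow> (nat \<Rightarrow> complex mat) \<Rightarrow> (nat \<Rightarrow> complex mat) \<Rightarrow> complex vec \<Rightarrow>
   (nat \<Rightarrow> complex) \<Rightarrow> complex vec \<Rightarrow> real \<Rightarrow> real \<Rightarrow> complex vec set" where
  "eigvec_perturbations k l m A E g lam x \<delta> \<epsilon> = {dx \<in> carrier_vec l. \<exists>dA dlam.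
     (\<forall>i \<le> m. dA i \<in> carrier_mat k l \<and> spectral_norm (dA i) \<le> \<epsilon> * spectral_norm (E i)) \<and>
     pencil k l m (\<lambda>i. A i + dA i) (\<lambda>i. lam i + dlam i) *\<^sub>v (x + dx) = 0\<^sub>v k \<and>
     x \<bullet>c g = 1 \<and> (x + dx) \<bullet>c g = 1 \<and>
     L2_set (\<lambda>i. cmod (dlam i)) {1..m} < \<delta> \<and> vnorm dx < \<delta>}"

text \<open>The relation ``\<open>\<kappa>(x) = K\<close>''. The local branch through the given eigenpair is singled out by
  keeping the perturbed eigenpairs in a fixed \<open>\<delta>\<close>-neighbourhood while \<open>\<epsilon>\<close> tends to \<open>0\<close>; the limit is
  required to be the same for every sufficiently small \<open>\<delta>\<close>. For positive \<open>\<epsilon>\<close> and \<open>\<delta>\<close> the supremum is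
  over a bounded set containing \<open>0\<close> (when $g^H x = 1$ and \<open>x\<close> is an eigenvector), so the real-valued
  supremum is the intended one.\<close>

definition has_eigvec_condition_number ::
  "nat \<Rightarrow> nat \<Rightarrow> nat \<Rightarrow> (nat \<Rightarrow> complex mat) \<Rightarrow> (nat \<Rightarrow> complex mat) \<Rightarrow> complex vec \<Rightarrow>
   (nat \<Rightarrow> complex) \<Rightarrow> complex vec \<Rightarrow> real \<Rightarrow> bool" where
  "has_eigvec_condition_number k l m A E g lam x K \<longleftrightarrow>
     (\<forall>\<^sub>F \<delta> in at_right 0.
        ((\<lambda>\<epsilon>. SUP dx \<in> eigvec_perturbations k l m A E g lam x \<delta> \<epsilon>. vnorm dx / (\<epsilon> * vnorm x))
           \<longlongrightarrow> K) (at_right 0))"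

lemma has_eigvec_condition_number_unique:
  assumes "has_eigvec_condition_number k l m A E g lam x K"
    and "has_eigvec_condition_number k l m A E g lam x K'"
  shows "K = K'"
proof -
  have "\<forall>\<^sub>F \<delta> in at_right (0 :: real). K = K'"
    using assms unfolding has_eigvec_condition_number_def
    by eventually_elim (rule tendsto_unique[OF trivial_limit_at_right_real])
  then show ?thesis by simp
qed

end

theory Submission
  imports Defs
begin

text \<open>
  Write \<open>P\<close> for the pencil at the eigenvalue. Since \<open>P x = 0\<close>, moving the eigenvalue by \<open>c\<close> and the
  eigenvector by \<open>d\<close> changes the value of the pencil at the vector by exactly
  \<open>(\<Sum>\<^sub>i c\<^sub>i A\<^sub>i x + P d) + \<Sum>\<^sub>i c\<^sub>i A\<^sub>i d\<close>, a linear part and a quadratic remainder (\<open>pencil_shift\<close>). Call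
  the linear part the bordered map of \<open>(c, d)\<close>, with \<open>d\<close> restricted to the hyperplane \<open>g\<^sup>H d = 0\<close>.
  Its domain has dimension \<open>m + (l - 1) = k\<close>, and algebraic simplicity is what makes it injective
  (\<open>algebraically_simple_kernel\<close>): the derivative of a minor in the direction \<open>c\<close> is, by Cramer's rule,
  the minor with one column replaced by \<open>\<Sum>\<^sub>i c\<^sub>i A\<^sub>i x\<close>, divided by an entry of \<open>x\<close>
  (\<open>deriv_secular\<close>). If \<open>\<Sum>\<^sub>i c\<^sub>i A\<^sub>i x = - P d\<close>, Cramer's rule makes this vanish for every minor, so the
  full column rank of the Jacobian forces \<open>c = 0\<close>; a second kernel vector of \<open>P\<close> would make the whole
  Jacobian vanish.

  So the bordered map is bijective. Because \<open>W\<^sup>H\<close> annihilates all \<open>A\<^sub>i x\<close> and the columns of \<open>V\<close> span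
  the hyperplane, it follows that \<open>S = W\<^sup>H P V\<close> is invertible (\<open>S_inverse\<close>), and \<open>R = V S\<^sup>-\<^sup>1 W\<^sup>H\<close>
  reads off \<open>d\<close> from the value of the bordered map at \<open>(c, d)\<close> (\<open>R_bordered\<close>).

  Upper bound (\<open>eigvec_perturbation_upper\<close>). A perturbed eigenpair makes the bordered map equal to
  minus the sum of the quadratic remainder and of the perturbing pencil at the perturbed eigenvector. Applying \<open>R\<close> gives
  \<open>d = O(\<epsilon>)\<close> as soon as the eigenvalue stays in a small fixed neighbourhood; the inverse of the
  bordered map then gives \<open>c = O(\<epsilon>)\<close>, and a second application of \<open>R\<close> gives
  \<open>\<parallel>d\<parallel> \<le> \<epsilon> \<parallel>R\<parallel> \<gamma> \<parallel>x\<parallel> + O(\<epsilon>\<^sup>2)\<close>.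

  Lower bound (\<open>eigvec_perturbation_lower\<close>). The order of construction is reversed, so that no
  implicit function theorem enters. Choose \<open>w\<close> in the unit ball with \<open>\<parallel>R w\<parallel>\<close> close to \<open>\<parallel>R\<parallel>\<close>, solve
  the linear problem with right-hand side \<open>w\<close>, and step along its solution by almost \<open>\<epsilon> \<gamma> \<parallel>x\<parallel>\<close>. The
  resulting pair is not an eigenpair, but its residual has norm slightly below \<open>\<epsilon> \<gamma> \<parallel>x\<parallel>\<close>, and such a
  residual is removed by rank-one perturbations of the coefficients of the admissible size
  (\<open>pencil_backward_error\<close>). The two bounds squeeze the supremum (\<open>eigvec_condition_number\<close>).
\<close>

section \<open>Euclidean and spectral norms\<close>

lemma vnorm_nonneg [simp]: "0 \<le> vnorm v"
  by (simp add: vnorm_def)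

lemma vnorm_zero [simp]: "vnorm (0\<^sub>v n) = 0"
  by (simp add: vnorm_def L2_set_def)

lemma cmod_index_le_vnorm:
  assumes "i < dim_vec v"
  shows "cmod (v $ i) \<le> vnorm v"
  unfolding vnorm_def
  using member_le_L2_set[of "{..<dim_vec v}" i "\<lambda>i. cmod (v $ i)"] assms by simp

lemma vnorm_eq_0:
  assumes "vnorm v = 0"
  shows "v = 0\<^sub>v (dim_vec v)"
proof (rule eq_vecI)
  fix i assume "i < dim_vec (0\<^sub>v (dim_vec v) :: complex vec)"
  then show "v $ i = 0\<^sub>v (dim_vec v) $ i"
    using cmod_index_le_vnorm[of i v] assms by simp
qed simp

lemma vnorm_smult: "vnorm (c \<cdot>\<^sub>v v) = cmod c * vnorm v"
proof -
  have "vnorm (c \<cdot>\<^sub>v v) = L2_set (\<lambda>i. cmod c * cmod (v $ i)) {..<dim_vec v}"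
    unfolding vnorm_def by (intro L2_set_cong) (simp_all add: norm_mult)
  then show ?thesis by (simp add: vnorm_def L2_set_right_distrib)
qed

lemma vnorm_add:
  assumes "v \<in> carrier_vec n" "w \<in> carrier_vec n"
  shows "vnorm (v + w) \<le> vnorm v + vnorm w"
proof -
  have "vnorm (v + w) \<le> L2_set (\<lambda>i. cmod (v $ i) + cmod (w $ i)) {..<n}"
    using assms by (auto simp: vnorm_def norm_triangle_ineq intro!: L2_set_mono)
  also have "\<dots> \<le> vnorm v + vnorm w"
    using assms L2_set_triangle_ineq[of "\<lambda>i. cmod (v $ i)" "\<lambda>i. cmod (w $ i)" "{..<n}"]
    by (simp add: vnorm_def)
  finally show ?thesis .
qed

lemma vnorm_scalar_prod:
  assumes "v \<in> carrier_vec n" "w \<in> carrier_vec n"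
  shows "cmod (v \<bullet>c w) \<le> vnorm v * vnorm w"
proof -
  have "cmod (v \<bullet>c w) \<le> (\<Sum>i<n. cmod (v $ i) * cmod (w $ i))"
    using assms unfolding scalar_prod_def
    by (intro order.trans[OF norm_sum]) (auto simp: norm_mult atLeast0LessThan)
  also have "\<dots> \<le> vnorm v * vnorm w"
    using assms L2_set_mult_ineq[of "\<lambda>i. cmod (v $ i)" "\<lambda>i. cmod (w $ i)" "{..<n}"]
    by (simp add: vnorm_def)
  finally show ?thesis .
qed

lemma scalar_prod_self:
  assumes "v \<in> carrier_vec n"
  shows "v \<bullet>c v = complex_of_real ((vnorm v)\<^sup>2)"
proof -
  have "v \<bullet>c v = (\<Sum>i<n. complex_of_real ((cmod (v $ i))\<^sup>2))"
    using assms unfolding scalar_prod_def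
    by (auto simp: atLeast0LessThan complex_norm_square simp del: of_real_power intro!: sum.cong)
  also have "\<dots> = complex_of_real ((vnorm v)\<^sup>2)"
    using assms by (simp add: vnorm_def L2_set_def sum_nonneg)
  finally show ?thesis .
qed

lemma bdd_above_mult_mat_vec:
  "bdd_above ((\<lambda>v. vnorm (A *\<^sub>v v)) ` {v \<in> carrier_vec (dim_col A). vnorm v \<le> 1})"
proof (rule bdd_aboveI2)
  fix v assume v: "v \<in> {v \<in> carrier_vec (dim_col A). vnorm v \<le> 1}"
  have "vnorm (A *\<^sub>v v) \<le> (\<Sum>i<dim_row A. cmod ((A *\<^sub>v v) $ i))"
    unfolding vnorm_def using L2_set_le_sum[of "{..<dim_row A}" "\<lambda>i. cmod ((A *\<^sub>v v) $ i)"] by simp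
  also have "\<dots> \<le> (\<Sum>i<dim_row A. \<Sum>j<dim_col A. cmod (A $$ (i, j)))"
  proof (rule sum_mono)
    fix i assume i: "i \<in> {..<dim_row A}"
    have "cmod ((A *\<^sub>v v) $ i) \<le> (\<Sum>j<dim_col A. cmod (A $$ (i, j)) * cmod (v $ j))"
      using i v unfolding index_mult_mat_vec[of i A v, OF i[simplified]] scalar_prod_def
      by (intro order.trans[OF norm_sum]) (auto simp: norm_mult atLeast0LessThan)
    also have "\<dots> \<le> (\<Sum>j<dim_col A. cmod (A $$ (i, j)))"
      using v by (intro sum_mono mult_left_le) (auto intro: order.trans[OF cmod_index_le_vnorm])
    finally show "cmod ((A *\<^sub>v v) $ i) \<le> (\<Sum>j<dim_col A. cmod (A $$ (i, j)))" .
  qed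
  finally show "vnorm (A *\<^sub>v v) \<le> (\<Sum>i<dim_row A. \<Sum>j<dim_col A. cmod (A $$ (i, j)))" .
qed

lemma spectral_norm_nonneg [simp]: "0 \<le> spectral_norm A"
  unfolding spectral_norm_def
  by (rule cSUP_upper2[OF bdd_above_mult_mat_vec, of "0\<^sub>v (dim_col A)"]) auto

lemma vnorm_mult_mat_vec:
  assumes "A \<in> carrier_mat nr nc" "v \<in> carrier_vec nc"
  shows "vnorm (A *\<^sub>v v) \<le> spectral_norm A * vnorm v"
proof (cases "vnorm v = 0")
  case True
  then have "v = 0\<^sub>v nc" using vnorm_eq_0[of v] assms by simp
  then have "A *\<^sub>v v = 0\<^sub>v nr" using assms by auto
  then show ?thesis using True by simp
next
  case False
  define c where "c = complex_of_real (1 / vnorm v)"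
  have c: "cmod c * vnorm v = 1" using False by (simp add: c_def norm_divide)
  have "vnorm (A *\<^sub>v (c \<cdot>\<^sub>v v)) \<le> spectral_norm A"
    unfolding spectral_norm_def
    by (rule cSUP_upper[OF _ bdd_above_mult_mat_vec]) (use assms c in \<open>auto simp: vnorm_smult\<close>)
  then have "cmod c * vnorm (A *\<^sub>v v) \<le> spectral_norm A"
    using assms by (simp add: mult_mat_vec[of A nr nc] vnorm_smult)
  then have "(cmod c * vnorm (A *\<^sub>v v)) * vnorm v \<le> spectral_norm A * vnorm v"
    by (rule mult_right_mono) simp
  then have "(cmod c * vnorm v) * vnorm (A *\<^sub>v v) \<le> spectral_norm A * vnorm v"
    by (simp add: mult_ac)
  then show ?thesis unfolding c by simp
qed

lemma spectral_norm_le: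
  assumes "A \<in> carrier_mat nr nc"
    and "\<And>v. v \<in> carrier_vec nc \<Longrightarrow> vnorm v \<le> 1 \<Longrightarrow> vnorm (A *\<^sub>v v) \<le> b"
  shows "spectral_norm A \<le> b"
  unfolding spectral_norm_def using assms by (intro cSUP_least) (auto intro!: exI[of _ "0\<^sub>v nc"])

lemma spectral_norm_less_iff:
  assumes "A \<in> carrier_mat nr nc"
  shows "a < spectral_norm A \<longleftrightarrow> (\<exists>v \<in> carrier_vec nc. vnorm v \<le> 1 \<and> a < vnorm (A *\<^sub>v v))"
  unfolding spectral_norm_def using assms
  by (subst less_cSUP_iff[OF _ bdd_above_mult_mat_vec])
    (auto simp: Bex_def intro: exI[of "\<lambda>v. v \<in> carrier_vec nc \<and> vnorm v \<le> 1" "0\<^sub>v nc"])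

text \<open>The matrix \<open>c r y\<^sup>H\<close>; for a vector \<open>r\<close> that is to be hit, taking \<open>y\<close> to be the vector it is
  applied to makes its norm as small as possible.\<close>
definition rank_one :: "complex \<Rightarrow> complex vec \<Rightarrow> complex vec \<Rightarrow> complex mat" where
  "rank_one c r y = mat (dim_vec r) (dim_vec y) (\<lambda>(i, j). c * r $ i * cnj (y $ j))"

lemma rank_one_carrier [simp]:
  "r \<in> carrier_vec nr \<Longrightarrow> y \<in> carrier_vec nc \<Longrightarrow> rank_one c r y \<in> carrier_mat nr nc"
  by (auto simp: rank_one_def)

lemma rank_one_mult_vec:
  assumes "v \<in> carrier_vec (dim_vec y)"
  shows "rank_one c r y *\<^sub>v v = (c * (v \<bullet>c y)) \<cdot>\<^sub>v r"
  using assms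
  by (intro eq_vecI)
    (auto simp: rank_one_def scalar_prod_def sum_distrib_left mult_ac intro!: sum.cong)

lemma spectral_norm_rank_one: "spectral_norm (rank_one c r y) \<le> cmod c * vnorm r * vnorm y"
proof (rule spectral_norm_le)
  show "rank_one c r y \<in> carrier_mat (dim_vec r) (dim_vec y)" by simp
  fix v assume v: "v \<in> carrier_vec (dim_vec y)" "vnorm v \<le> 1"
  have "cmod (v \<bullet>c y) \<le> vnorm v * vnorm y"
    using vnorm_scalar_prod[OF v(1), of y] by simp
  also have "\<dots> \<le> vnorm y" using v(2) by (simp add: mult_left_le_one_le)
  finally have "cmod (v \<bullet>c y) \<le> vnorm y" .
  then have "(cmod c * vnorm r) * cmod (v \<bullet>c y) \<le> (cmod c * vnorm r) * vnorm y"
    by (intro mult_left_mono) simp_all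
  then show "vnorm (rank_one c r y *\<^sub>v v) \<le> cmod c * vnorm r * vnorm y"
    using v by (simp add: rank_one_mult_vec vnorm_smult norm_mult mult_ac)
qed

section \<open>Linear combinations and pencils applied to a vector\<close>

definition lin_sum :: "nat \<Rightarrow> nat \<Rightarrow> (nat \<Rightarrow> complex) \<Rightarrow> (nat \<Rightarrow> complex vec) \<Rightarrow> complex vec" where
  "lin_sum k m c f = vec k (\<lambda>r. \<Sum>i = 1..m. c i * f i $ r)"

lemma lin_sum_carrier [simp]: "lin_sum k m c f \<in> carrier_vec k"
  and dim_lin_sum [simp]: "dim_vec (lin_sum k m c f) = k"
  and index_lin_sum [simp]: "r < k \<Longrightarrow> lin_sum k m c f $ r = (\<Sum>i = 1..m. c i * f i $ r)"
  by (simp_all add: lin_sum_def)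

lemma vnorm_lin_sum:
  assumes "\<And>i. i \<in> {1..m} \<Longrightarrow> f i \<in> carrier_vec k"
  shows "vnorm (lin_sum k m c f) \<le> (\<Sum>i = 1..m. cmod (c i) * vnorm (f i))"
  using assms
proof (induction m)
  case 0
  have "lin_sum k 0 c f = 0\<^sub>v k" by (intro eq_vecI) auto
  then show ?case by simp
next
  case (Suc m)
  have f: "f (Suc m) \<in> carrier_vec k" by (rule Suc.prems) simp
  have "lin_sum k (Suc m) c f = lin_sum k m c f + c (Suc m) \<cdot>\<^sub>v f (Suc m)"
    using f by (intro eq_vecI) auto
  then have "vnorm (lin_sum k (Suc m) c f) \<le> vnorm (lin_sum k m c f) + vnorm (c (Suc m) \<cdot>\<^sub>v f (Suc m))"
    using f by (auto intro!: vnorm_add[of _ k])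
  also have "\<dots> \<le> (\<Sum>i = 1..Suc m. cmod (c i) * vnorm (f i))"
    using Suc.IH Suc.prems by (simp add: vnorm_smult)
  finally show ?case .
qed

lemma mult_mat_vec_lin_sum:
  assumes "B \<in> carrier_mat n k"
    and "\<And>i. i \<in> {1..m} \<Longrightarrow> f i \<in> carrier_vec k"
  shows "B *\<^sub>v lin_sum k m c f = lin_sum n m c (\<lambda>i. B *\<^sub>v f i)"
proof (rule eq_vecI)
  fix r assume "r < dim_vec (lin_sum n m c (\<lambda>i. B *\<^sub>v f i))"
  then have r: "r < n" by simp
  have "(B *\<^sub>v lin_sum k m c f) $ r = (\<Sum>j<k. \<Sum>i = 1..m. B $$ (r, j) * (c i * f i $ j))"
    using assms r by (auto simp: scalar_prod_def sum_distrib_left atLeast0LessThan)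
  also have "\<dots> = (\<Sum>i = 1..m. \<Sum>j<k. B $$ (r, j) * (c i * f i $ j))" by (rule sum.swap)
  also have "\<dots> = (\<Sum>i = 1..m. c i * (B *\<^sub>v f i) $ r)"
    using assms(1) r carrier_vecD[OF assms(2)]
    by (intro sum.cong refl) (auto simp: scalar_prod_def sum_distrib_left atLeast0LessThan mult_ac)
  finally show "(B *\<^sub>v lin_sum k m c f) $ r = lin_sum n m c (\<lambda>i. B *\<^sub>v f i) $ r"
    using r by simp
qed (use assms in auto)

lemma pencil_carrier [simp]: "pencil k l m A lam \<in> carrier_mat k l"
  and dim_pencil [simp]: "dim_row (pencil k l m A lam) = k" "dim_col (pencil k l m A lam) = l"
  by (simp_all add: pencil_def)

lemma pencil_mult_vec:
  assumes "\<And>i. i \<le> m \<Longrightarrow> A i \<in> carrier_mat k l" and "v \<in> carrier_vec l"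
  shows "pencil k l m A lam *\<^sub>v v = A 0 *\<^sub>v v + lin_sum k m lam (\<lambda>i. A i *\<^sub>v v)"
proof (rule eq_vecI)
  fix r assume "r < dim_vec (A 0 *\<^sub>v v + lin_sum k m lam (\<lambda>i. A i *\<^sub>v v))"
  then have r: "r < k" by simp
  have A: "dim_row (A i) = k" "dim_col (A i) = l" if "i \<le> m" for i
    using assms(1)[OF that] by auto
  have "(pencil k l m A lam *\<^sub>v v) $ r =
      (\<Sum>j<l. A 0 $$ (r, j) * v $ j) + (\<Sum>j<l. \<Sum>i = 1..m. lam i * A i $$ (r, j) * v $ j)"
    using assms r by (auto simp: pencil_def scalar_prod_def atLeast0LessThan
        distrib_right sum.distrib sum_distrib_right)
  also have "(\<Sum>j<l. \<Sum>i = 1..m. lam i * A i $$ (r, j) * v $ j) =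
      (\<Sum>i = 1..m. \<Sum>j<l. lam i * A i $$ (r, j) * v $ j)"
    by (rule sum.swap)
  also have "\<dots> = (\<Sum>i = 1..m. lam i * (A i *\<^sub>v v) $ r)"
    using assms(2) r A
    by (intro sum.cong refl) (auto simp: scalar_prod_def sum_distrib_left atLeast0LessThan mult_ac)
  finally show "(pencil k l m A lam *\<^sub>v v) $ r = (A 0 *\<^sub>v v + lin_sum k m lam (\<lambda>i. A i *\<^sub>v v)) $ r"
    using assms(2) r A by (auto simp: scalar_prod_def atLeast0LessThan)
qed (use assms(1)[of 0] in auto)

section \<open>Injective matrices and adjoints\<close>

text \<open>The rank is defined through the set of columns, so a repeated column has to be excluded first:
  it would leave fewer than \<open>nc\<close> vectors to span a space of dimension \<open>nc\<close>.\<close>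
lemma (in vec_space) full_column_rank_injective:
  assumes A: "A \<in> carrier_mat n nc" and rank: "rank A = nc"
    and v: "v \<in> carrier_vec nc" "A *\<^sub>v v = 0\<^sub>v n"
  shows "v = 0\<^sub>v nc"
proof -
  obtain S where S: "maximal S (\<lambda>T. T \<subseteq> set (cols A) \<and> lin_indpt T)"
    using maximal_exists_superset[of "set (cols A)" "\<lambda>T. T \<subseteq> set (cols A) \<and> lin_indpt T" "{}"]
    by (auto simp: lin_dep_def)
  then have "card S \<le> card (set (cols A))" by (simp add: card_mono maximal_def)
  then have "length (cols A) \<le> card (set (cols A))"
    using rank_card_indpt[OF A S] rank A by simp
  then have "distinct (cols A)"
    by (intro card_distinct antisym card_length)
  then show ?thesis
    using full_rank_lin_indpt[OF A rank] lin_depI[OF A v(1) _ v(2)] by blast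
qed

lemma injective_square_mat_inverse:
  fixes A :: "complex mat"
  assumes A: "A \<in> carrier_mat n n"
    and inj: "\<And>v. v \<in> carrier_vec n \<Longrightarrow> A *\<^sub>v v = 0\<^sub>v n \<Longrightarrow> v = 0\<^sub>v n"
  obtains B where "mat_inverse A = Some B" "B \<in> carrier_mat n n" "A * B = 1\<^sub>m n" "B * A = 1\<^sub>m n"
proof -
  have "Determinant.det A \<noteq> 0"
    using inj det_0_iff_vec_prod_zero_field[OF A] by blast
  then have "A \<in> Units (ring_mat TYPE(complex) n ())"
    by (rule det_non_zero_imp_unit[OF A])
  then obtain B where B: "mat_inverse A = Some B"
    using mat_inverse(1)[OF A, where b = "()"] by (cases "mat_inverse A") auto
  show ?thesis
    using that[OF B] mat_inverse(2)[OF A B] by simp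
qed

lemma smult_mat_mult_vec:
  fixes A :: "complex mat"
  assumes "A \<in> carrier_mat nr nc" "v \<in> carrier_vec nc"
  shows "(c \<cdot>\<^sub>m A) *\<^sub>v v = c \<cdot>\<^sub>v (A *\<^sub>v v)"
  using assms by (intro eq_vecI) (auto simp: scalar_prod_def sum_distrib_left mult_ac)

lemma mat_adjoint_carrier [simp]: "W \<in> carrier_mat nr nc \<Longrightarrow> mat_adjoint W \<in> carrier_mat nc nr"
  and dim_mat_adjoint [simp]: "dim_row (mat_adjoint W) = dim_col W" "dim_col (mat_adjoint W) = dim_row W"
  by (auto simp: mat_adjoint_def)

lemma index_mat_adjoint [simp]:
  "i < dim_col W \<Longrightarrow> j < dim_row W \<Longrightarrow> mat_adjoint W $$ (i, j) = conjugate (W $$ (j, i))"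
  by (simp add: mat_adjoint_def mat_of_rows_def)

lemma mat_adjoint_scalar_prod:
  fixes W :: "complex mat"
  assumes W: "W \<in> carrier_mat nr nc" and b: "b \<in> carrier_vec nr" and u: "u \<in> carrier_vec nc"
  shows "(mat_adjoint W *\<^sub>v b) \<bullet>c u = b \<bullet>c (W *\<^sub>v u)"
proof -
  have "(mat_adjoint W *\<^sub>v b) \<bullet>c u = (\<Sum>i<nc. \<Sum>j<nr. b $ j * cnj (W $$ (j, i)) * cnj (u $ i))"
    using assms by (auto simp: scalar_prod_def sum_distrib_left sum_distrib_right atLeast0LessThan mult_ac intro!: sum.cong)
  also have "\<dots> = (\<Sum>j<nr. \<Sum>i<nc. b $ j * cnj (W $$ (j, i)) * cnj (u $ i))"
    by (rule sum.swap)
  also have "\<dots> = b \<bullet>c (W *\<^sub>v u)"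
    using assms by (auto simp: scalar_prod_def sum_distrib_left atLeast0LessThan mult_ac intro!: sum.cong)
  finally show ?thesis .
qed

section \<open>Derivatives of determinants at a singular matrix\<close>

text \<open>Expansion along the replaced column, whose cofactors do not see that column. This holds for
  singular \<open>A\<close> too, and exhibits the determinant as a linear function of the new column.\<close>
lemma det_replace_col:
  assumes A: "A \<in> carrier_mat n n" and b: "b \<in> carrier_vec n" and k: "k < n"
  shows "Determinant.det (replace_col A b k) = row (adj_mat A) k \<bullet> b"
proof -
  have R: "replace_col A b k \<in> carrier_mat n n" using A by (auto simp: replace_col_def)
  have "mat_delete (replace_col A b k) i k = mat_delete A i k" for i
    by (intro eq_matI) (auto simp: replace_col_def mat_delete_def)
  then have "Determinant.det (replace_col A b k) = (\<Sum>i<n. b $ i * cofactor A i k)"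
    using A k laplace_expansion_column[OF R k] by (simp add: cofactor_def replace_col_def)
  also have "\<dots> = row (adj_mat A) k \<bullet> b"
    using A b k by (simp add: scalar_prod_def adj_mat_def atLeast0LessThan mult.commute)
  finally show ?thesis .
qed

lemma det_replace_col_lin_sum:
  assumes A: "A \<in> carrier_mat n n" and i: "i < n"
    and f: "\<And>j. j \<in> {1..m} \<Longrightarrow> f j \<in> carrier_vec n"
  shows "(\<Sum>j = 1..m. c j * Determinant.det (replace_col A (f j) i)) =
    Determinant.det (replace_col A (lin_sum n m c f) i)"
proof -
  have "Determinant.det (replace_col A (lin_sum n m c f) i) =
      (\<Sum>r<n. \<Sum>j = 1..m. c j * (row (adj_mat A) i $ r * f j $ r))"
    by (simp add: det_replace_col[OF A _ i] scalar_prod_def sum_distrib_left atLeast0LessThan mult_ac)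
  also have "\<dots> = (\<Sum>j = 1..m. \<Sum>r<n. c j * (row (adj_mat A) i $ r * f j $ r))"
    by (rule sum.swap)
  also have "\<dots> = (\<Sum>j = 1..m. c j * Determinant.det (replace_col A (f j) i))"
    using carrier_vecD[OF f] by (intro sum.cong refl)
      (simp add: det_replace_col[OF A f i] scalar_prod_def sum_distrib_left atLeast0LessThan)
  finally show ?thesis by simp
qed

text \<open>Since \<open>z\<close> vanishes at \<open>i\<close>, it remains in the kernel whatever column \<open>i\<close> is replaced by.\<close>
lemma det_replace_col_kernel:
  fixes M :: "complex mat"
  assumes M: "M \<in> carrier_mat n n" and i: "i < n"
    and z: "z \<in> carrier_vec n" "M *\<^sub>v z = 0\<^sub>v n" "z \<noteq> 0\<^sub>v n" "z $ i = 0"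
  shows "Determinant.det (replace_col M b i) = 0"
proof -
  have R: "replace_col M b i \<in> carrier_mat n n" using M by (auto simp: replace_col_def)
  have "replace_col M b i *\<^sub>v z = M *\<^sub>v z"
    using M z(1,4) by (intro eq_vecI) (auto simp: replace_col_def scalar_prod_def intro!: sum.cong)
  then show ?thesis using z det_0_iff_vec_prod_zero[OF R] by auto
qed

lemma isCont_det:
  fixes M :: "complex \<Rightarrow> complex mat"
  assumes M: "\<And>t. M t \<in> carrier_mat n n"
    and cont: "\<And>r c. r < n \<Longrightarrow> c < n \<Longrightarrow> isCont (\<lambda>t. M t $$ (r, c)) a"
  shows "isCont (\<lambda>t. Determinant.det (M t)) a"
proof -
  have "(\<lambda>t. Determinant.det (M t)) =
      (\<lambda>t. \<Sum>p\<in>{p. p permutes {0..<n}}. signof p * (\<Prod>i = 0..<n. M t $$ (i, p i)))"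
    using det_def'[OF M] by blast
  moreover have "p i < n" if "p permutes {0..<n}" "i < n" for p i
    using permutes_in_image[OF that(1), of i] that(2) by simp
  ultimately show ?thesis by (auto intro!: continuous_intros cont)
qed

text \<open>With \<open>N = M + (t - a) B\<close> one has \<open>N x = (t - a) B x\<close>, so Cramer's rule gives
  \<open>x\<^sub>i det N = (t - a) det (N with column i replaced by B x)\<close>: a factor \<open>t - a\<close> splits off, and the
  derivative is the value at \<open>a\<close> of the other factor, which is continuous. A kernel vector thus replaces the
  adjugate of Jacobi's formula, without a case distinction on the rank of \<open>M\<close>.\<close>
lemma has_field_derivative_det_singular:
  fixes M B :: "complex mat"
  assumes M: "M \<in> carrier_mat n n" and B: "B \<in> carrier_mat n n" and x: "x \<in> carrier_vec n"
    and Mx: "M *\<^sub>v x = 0\<^sub>v n" and i: "i < n" "x $ i \<noteq> 0"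
  shows "((\<lambda>t. Determinant.det (M + (t - a) \<cdot>\<^sub>m B)) has_field_derivative
    Determinant.det (replace_col M (B *\<^sub>v x) i) / x $ i) (at a)"
proof -
  define D where "D t = Determinant.det (replace_col (M + (t - a) \<cdot>\<^sub>m B) (B *\<^sub>v x) i) / x $ i" for t
  have N: "M + (t - a) \<cdot>\<^sub>m B \<in> carrier_mat n n" for t using M B by simp
  have *: "Determinant.det (M + (t - a) \<cdot>\<^sub>m B) = D t * (t - a)" for t
  proof -
    let ?N = "M + (t - a) \<cdot>\<^sub>m B"
    have Nx: "?N *\<^sub>v x = (t - a) \<cdot>\<^sub>v (B *\<^sub>v x)"
      using M B x Mx by (simp add: add_mult_distrib_mat_vec[of M n n] smult_mat_mult_vec[of B n n])
    have "x $ i * Determinant.det ?N = Determinant.det (replace_col ?N ((t - a) \<cdot>\<^sub>v (B *\<^sub>v x)) i)"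
      using cramer_lemma_mat[OF N[of t] x i(1)] by (simp add: Nx)
    also have "\<dots> = (t - a) * Determinant.det (replace_col ?N (B *\<^sub>v x) i)"
      using B x adj_mat(1)[OF N[of t]] i(1) by (simp add: det_replace_col[OF N[of t] _ i(1)])
    finally show ?thesis using i(2) by (simp add: D_def field_simps)
  qed
  have "isCont (\<lambda>t. Determinant.det (replace_col (M + (t - a) \<cdot>\<^sub>m B) (B *\<^sub>v x) i)) a"
  proof (rule isCont_det[of _ n])
    fix r c assume "r < n" "c < n"
    then have "replace_col (M + (t - a) \<cdot>\<^sub>m B) (B *\<^sub>v x) i $$ (r, c) =
        (if c = i then (B *\<^sub>v x) $ r else M $$ (r, c) + (t - a) * B $$ (r, c))" for t
      using M B by (simp add: replace_col_def)
    then show "isCont (\<lambda>t. replace_col (M + (t - a) \<cdot>\<^sub>m B) (B *\<^sub>v x) i $$ (r, c)) a"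
      by (cases "c = i") (simp_all add: continuous_intros)
  qed (use M B in \<open>auto simp: replace_col_def\<close>)
  then have "isCont D a"
    unfolding D_def using i(2) by (intro continuous_intros)
  moreover have M0: "M + 0 \<cdot>\<^sub>m B = M" using M B by auto
  moreover have "Determinant.det M = 0" using *[of a] M0 by simp
  ultimately show ?thesis
    unfolding DERIV_caratheodory_within CARAT_DERIV
    using * by (intro exI[of _ D]) (auto simp: D_def)
qed

section \<open>Simple eigenvalues\<close>

lemma row_selection_submatrix:
  assumes A: "A \<in> carrier_mat k l" and s: "s \<subseteq> {..<k}" "card s = l"
  shows "submatrix A s UNIV \<in> carrier_mat l l"
    and "r < l \<Longrightarrow> pick s r < k"
    and "r < l \<Longrightarrow> c < l \<Longrightarrow> submatrix A s UNIV $$ (r, c) = A $$ (pick s r, c)"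
proof -
  have *: "{i. i < dim_row A \<and> i \<in> s} = s" "{j. j < dim_col A \<and> j \<in> (UNIV :: nat set)} = {..<l}"
    using A s(1) by auto
  show "submatrix A s UNIV \<in> carrier_mat l l"
    unfolding submatrix_def * using s by simp
  show "pick s r < k" if "r < l"
    using pick_in_set_le[of r s] s that by auto
  show "submatrix A s UNIV $$ (r, c) = A $$ (pick s r, c)" if "r < l" "c < l"
  proof -
    have "r < card {i. i < dim_row A \<and> i \<in> s}" unfolding * using s(2) that by simp
    moreover have "c < card {j. j < dim_col A \<and> j \<in> (UNIV :: nat set)}" unfolding * using that by simp
    ultimately show ?thesis using submatrix_index[of r A s c UNIV] by (simp only: pick_UNIV)
  qed
qed

text \<open>Passing to the rows in \<open>s\<close> keeps kernel vectors and linear relations; this is how statements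
  about the rectangular pencil reach its square submatrices.\<close>
lemma row_selection_mult_vec:
  assumes A: "A \<in> carrier_mat k l" and s: "s \<subseteq> {..<k}" "card s = l" and v: "v \<in> carrier_vec l"
  shows "submatrix A s UNIV *\<^sub>v v = vec l (\<lambda>r. (A *\<^sub>v v) $ pick s r)"
  using A v row_selection_submatrix[OF A s]
  by (intro eq_vecI) (auto simp: scalar_prod_def intro!: sum.cong)

lemma deriv_secular:
  assumes A: "\<And>i. i \<le> m \<Longrightarrow> A i \<in> carrier_mat k l" and s: "s \<subseteq> {..<k}" "card s = l"
    and x: "x \<in> carrier_vec l" "pencil k l m A lam *\<^sub>v x = 0\<^sub>v k" and i: "i < l" "x $ i \<noteq> 0"
    and j: "j \<in> {1..m}"
  shows "deriv (\<lambda>t. secular k l m A s (lam(j := t))) (lam j) =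
    Determinant.det (replace_col (submatrix (pencil k l m A lam) s UNIV)
      (vec l (\<lambda>r. (A j *\<^sub>v x) $ pick s r)) i) / x $ i"
proof -
  let ?M = "submatrix (pencil k l m A lam) s UNIV" and ?B = "submatrix (A j) s UNIV"
  note M = row_selection_submatrix[OF pencil_carrier s]
  note B = row_selection_submatrix[OF A s, of j]
  have pencil_upd: "pencil k l m A (lam(j := t)) $$ (r, c) =
      pencil k l m A lam $$ (r, c) + (t - lam j) * A j $$ (r, c)" if "r < k" "c < l" for t r c
  proof -
    have "(\<Sum>i = 1..m. (lam(j := t)) i * A i $$ (r, c)) =
        t * A j $$ (r, c) + (\<Sum>i\<in>{1..m} - {j}. (lam(j := t)) i * A i $$ (r, c))"
      using j by (subst sum.remove[of _ j]) auto
    also have "(\<Sum>i\<in>{1..m} - {j}. (lam(j := t)) i * A i $$ (r, c)) =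
        (\<Sum>i\<in>{1..m} - {j}. lam i * A i $$ (r, c))"
      by (intro sum.cong) auto
    finally show ?thesis
      using j sum.remove[of "{1..m}" j "\<lambda>i. lam i * A i $$ (r, c)"] that
      by (simp add: pencil_def algebra_simps)
  qed
  have "submatrix (pencil k l m A (lam(j := t))) s UNIV = ?M + (t - lam j) \<cdot>\<^sub>m ?B" for t
    using M B j by (intro eq_matI) (auto simp: pencil_upd)
  then have "secular k l m A s (lam(j := t)) = Determinant.det (?M + (t - lam j) \<cdot>\<^sub>m ?B)" for t
    by (simp add: secular_def)
  moreover have "?M *\<^sub>v x = 0\<^sub>v l"
    using row_selection_mult_vec[OF pencil_carrier s x(1)] x(2) M by auto
  moreover have "?B *\<^sub>v x = vec l (\<lambda>r. (A j *\<^sub>v x) $ pick s r)"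
    using j by (intro row_selection_mult_vec[OF A s x(1)]) auto
  ultimately show ?thesis
    using has_field_derivative_det_singular[OF M(1) B(1) x(1) _ i, where a = "lam j"] j
    by (auto intro!: DERIV_imp_deriv)
qed

text \<open>All derivatives of a secular equation are values of one linear form \<open>D s\<close> at the vectors \<open>A\<^sub>i x\<close>,
  so the full column rank of the Jacobian says that \<open>c\<close> vanishes once every \<open>D s\<close> vanishes at
  \<open>\<Sum>\<^sub>i c\<^sub>i A\<^sub>i x\<close>. By hypothesis this vector is \<open>- P d\<close>, at which \<open>D s\<close> is a multiple of a minor of \<open>P\<close>
  by Cramer's rule, hence zero. If \<open>d\<close> were not a multiple of \<open>x\<close>, a combination \<open>z\<close> of \<open>d\<close> and \<open>x\<close>
  vanishing at \<open>i\<close> would lie in the kernel of \<open>P\<close>, all \<open>D s\<close> would be zero, and then the Jacobian could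
  not have rank \<open>m \<ge> 1\<close>.\<close>
lemma algebraically_simple_kernel:
  assumes A: "\<And>i. i \<le> m \<Longrightarrow> A i \<in> carrier_mat k l" and "1 \<le> m"
    and eig: "eigenpair k l m A lam x" and simple: "algebraically_simple k l m A lam"
    and d: "d \<in> carrier_vec l"
    and eq: "lin_sum k m c (\<lambda>i. A i *\<^sub>v x) + pencil k l m A lam *\<^sub>v d = 0\<^sub>v k"
  shows "(\<forall>i \<in> {1..m}. c i = 0) \<and> (\<exists>\<alpha>. d = \<alpha> \<cdot>\<^sub>v x)"
proof -
  let ?P = "pencil k l m A lam" and ?L = "length (row_selections k l)"
  have x: "x \<in> carrier_vec l" "x \<noteq> 0\<^sub>v l" "?P *\<^sub>v x = 0\<^sub>v k"
    using eig by (auto simp: eigenpair_def)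
  obtain i where i: "i < l" "x $ i \<noteq> 0"
    using x(1,2) by (metis carrier_vecD eq_vecI index_zero_vec)
  define D where "D s b = Determinant.det (replace_col (submatrix ?P s UNIV) (vec l (\<lambda>r. b $ pick s r)) i)"
    for s and b :: "complex vec"
  have sel: "s \<subseteq> {..<k}" "card s = l" if "s \<in> set (row_selections k l)" for s
    using that by (auto simp: set_row_selections)
  have D_lin: "(\<Sum>j = 1..m. b j * D s (A j *\<^sub>v x)) = D s (lin_sum k m b (\<lambda>j. A j *\<^sub>v x))"
    if "s \<in> set (row_selections k l)" for b s
  proof -
    note M = row_selection_submatrix[OF pencil_carrier sel[OF that]]
    have "lin_sum l m b (\<lambda>j. vec l (\<lambda>r. (A j *\<^sub>v x) $ pick s r)) =
        vec l (\<lambda>r. lin_sum k m b (\<lambda>j. A j *\<^sub>v x) $ pick s r)"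
      using M(2) by (intro eq_vecI) auto
    then show ?thesis
      unfolding D_def
      using det_replace_col_lin_sum[OF M(1) i(1), of m "\<lambda>j. vec l (\<lambda>r. (A j *\<^sub>v x) $ pick s r)" b] by simp
  qed
  have inj: "b j = 0" if "\<And>s. s \<in> set (row_selections k l) \<Longrightarrow> D s (lin_sum k m b (\<lambda>j. A j *\<^sub>v x)) = 0"
    and j: "j \<in> {1..m}" for b j
  proof -
    let ?J = "secular_jacobian k l m A lam" and ?b = "vec m (\<lambda>j. b (Suc j))"
    have J: "?J \<in> carrier_mat ?L m" "vec_space.rank ?L ?J = m"
      using simple by (auto simp: secular_jacobian_def algebraically_simple_def)
    have "?J *\<^sub>v ?b = 0\<^sub>v ?L"
    proof (rule eq_vecI)
      fix r assume "r < dim_vec (0\<^sub>v ?L :: complex vec)"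
      then have r: "r < ?L" by simp
      let ?s = "row_selections k l ! r"
      have s: "?s \<in> set (row_selections k l)" using r by simp
      have "(?J *\<^sub>v ?b) $ r = (\<Sum>j<m. D ?s (A (Suc j) *\<^sub>v x) / x $ i * b (Suc j))"
        using r by (auto simp: secular_jacobian_def scalar_prod_def atLeast0LessThan D_def
            deriv_secular[OF A sel[OF s] x(1,3) i] intro!: sum.cong)
      also have "\<dots> = (\<Sum>j = 1..m. D ?s (A j *\<^sub>v x) / x $ i * b j)"
        by (simp add: sum.atLeast1_atMost_eq)
      also have "\<dots> = (\<Sum>j = 1..m. b j * D ?s (A j *\<^sub>v x)) / x $ i"
        by (simp add: sum_divide_distrib mult.commute)
      also have "\<dots> = 0" using that(1)[OF s] unfolding D_lin[OF s] by simp
      finally show "(?J *\<^sub>v ?b) $ r = 0\<^sub>v ?L $ r" using r by simp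
    qed (use J in auto)
    then have "?b = 0\<^sub>v m"
      using vec_space.full_column_rank_injective[OF J] by simp
    then have "?b $ (j - 1) = 0" using j by (subst \<open>?b = 0\<^sub>v m\<close>) auto
    moreover have "?b $ (j - 1) = b j" using j by (subst index_vec) auto
    ultimately show ?thesis by simp
  qed
  have *: "lin_sum k m c (\<lambda>j. A j *\<^sub>v x) = ?P *\<^sub>v (- d)"
  proof (rule eq_vecI)
    fix r assume "r < dim_vec (?P *\<^sub>v (- d))"
    then have r: "r < k" by simp
    have "(lin_sum k m c (\<lambda>j. A j *\<^sub>v x) + ?P *\<^sub>v d) $ r = 0" using r eq by simp
    then show "lin_sum k m c (\<lambda>j. A j *\<^sub>v x) $ r = (?P *\<^sub>v (- d)) $ r"
      using r d by (simp add: add_eq_0_iff2)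
  qed simp
  have c: "c j = 0" if j: "j \<in> {1..m}" for j
  proof (rule inj[OF _ j])
    fix s assume s: "s \<in> set (row_selections k l)"
    note M = row_selection_submatrix[OF pencil_carrier sel[OF s]]
    have "submatrix ?P s UNIV *\<^sub>v x = 0\<^sub>v l"
      using row_selection_mult_vec[OF pencil_carrier sel[OF s] x(1)] x(3) M by auto
    then have "Determinant.det (submatrix ?P s UNIV) = 0"
      using det_0_iff_vec_prod_zero[OF M(1)] x by blast
    moreover have "vec l (\<lambda>r. lin_sum k m c (\<lambda>j. A j *\<^sub>v x) $ pick s r) = submatrix ?P s UNIV *\<^sub>v (- d)"
      using row_selection_mult_vec[OF pencil_carrier sel[OF s], of "- d"] d by (simp add: *)
    ultimately show "D s (lin_sum k m c (\<lambda>j. A j *\<^sub>v x)) = 0"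
      unfolding D_def using cramer_lemma_mat[OF M(1) _ i(1), of "- d"] d by simp
  qed
  have "\<exists>\<alpha>. d = \<alpha> \<cdot>\<^sub>v x"
  proof (rule ccontr)
    assume not: "\<not> ?thesis"
    define z where "z = d - (d $ i / x $ i) \<cdot>\<^sub>v x"
    have z: "z \<in> carrier_vec l" "z $ i = 0" using d x(1) i by (auto simp: z_def)
    have z0: "z \<noteq> 0\<^sub>v l"
    proof
      assume "z = 0\<^sub>v l"
      then have "d $ r - d $ i / x $ i * x $ r = 0" if "r < l" for r
        using that d x(1) by (auto simp: z_def dest!: arg_cong[where f = "\<lambda>v. v $ r"])
      then have "d = (d $ i / x $ i) \<cdot>\<^sub>v x" using d x(1) by (intro eq_vecI) auto
      then show False using not by blast
    qed
    have "lin_sum k m c (\<lambda>j. A j *\<^sub>v x) = 0\<^sub>v k"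
      using c by (intro eq_vecI) auto
    then have "?P *\<^sub>v d = 0\<^sub>v k" using eq by (simp add: left_zero_vec[OF mult_mat_vec_carrier[OF pencil_carrier d]])
    then have "?P *\<^sub>v z = 0\<^sub>v k - (d $ i / x $ i) \<cdot>\<^sub>v 0\<^sub>v k"
      unfolding z_def using d x
      by (simp add: mult_minus_distrib_mat_vec[OF pencil_carrier] mult_mat_vec[OF pencil_carrier])
    then have Pz: "?P *\<^sub>v z = 0\<^sub>v k" by auto
    have "D s b = 0" if s: "s \<in> set (row_selections k l)" for s b
    proof -
      note M = row_selection_submatrix[OF pencil_carrier sel[OF s]]
      have "submatrix ?P s UNIV *\<^sub>v z = 0\<^sub>v l"
        using row_selection_mult_vec[OF pencil_carrier sel[OF s] z(1)] Pz M by auto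
      then show ?thesis
        unfolding D_def using det_replace_col_kernel[OF M(1) i(1) z(1) _ z0 z(2)] by blast
    qed
    \<comment> \<open>every coefficient vector would satisfy the criterion, the constant \<open>1\<close> included\<close>
    then have "(1 :: complex) = 0" using inj[of "\<lambda>_. 1" 1] \<open>1 \<le> m\<close> by simp
    then show False by simp
  qed
  with c show ?thesis by blast
qed

lemma pencil_mult_vec_carrier [simp]: "pencil k l m A lam *\<^sub>v v \<in> carrier_vec k"
  by (rule carrier_vecI) simp

section \<open>The bordered system of an eigenpair\<close>

text \<open>The name refers to the bordered system: the columns \<open>A\<^sub>1 x, \<dots>, A\<^sub>m x\<close> are put next to those of
  \<open>P\<close>, with the side condition \<open>g\<^sup>H d = 0\<close>.\<close>
locale bordered_eigenpair =
  fixes k l m :: nat and A :: "nat \<Rightarrow> complex mat"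
    and lam :: "nat \<Rightarrow> complex" and x g :: "complex vec" and V W :: "complex mat"
  assumes dims: "1 \<le> l" "1 \<le> m" "k = l + m - 1"
    and A: "\<And>i. i \<le> m \<Longrightarrow> A i \<in> carrier_mat k l"
    and eig: "eigenpair k l m A lam x"
    and simple: "algebraically_simple k l m A lam"
    and g: "g \<in> carrier_vec l" and xg: "x \<bullet>c g = 1"
    and V: "V \<in> carrier_mat l (l - 1)" and rank_V: "vec_space.rank l V = l - 1"
    and W: "W \<in> carrier_mat k (l - 1)" and rank_W: "vec_space.rank k W = l - 1"
    and Vg: "\<And>j. j < l - 1 \<Longrightarrow> col V j \<bullet>c g = 0"
    and WA: "\<And>i. i \<in> {1..m} \<Longrightarrow> mat_adjoint W *\<^sub>v (A i *\<^sub>v x) = 0\<^sub>v (l - 1)"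
begin

abbreviation "P \<equiv> pencil k l m A lam"
abbreviation "S \<equiv> mat_adjoint W * P * V"
abbreviation "R \<equiv> V * the (mat_inverse S) * mat_adjoint W"
abbreviation "bordered c d \<equiv> lin_sum k m c (\<lambda>i. A i *\<^sub>v x) + P *\<^sub>v d"

lemma x: "x \<in> carrier_vec l" "x \<noteq> 0\<^sub>v l" "P *\<^sub>v x = 0\<^sub>v k"
  using eig by (auto simp: eigenpair_def)

lemma bordered_injective:
  assumes d: "d \<in> carrier_vec l" "d \<bullet>c g = 0" and eq: "bordered c d = 0\<^sub>v k"
  shows "d = 0\<^sub>v l" and "i \<in> {1..m} \<Longrightarrow> c i = 0"
proof -
  obtain \<alpha> where \<alpha>: "d = \<alpha> \<cdot>\<^sub>v x" and c: "\<forall>i \<in> {1..m}. c i = 0"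
    using algebraically_simple_kernel[OF A dims(2) eig simple d(1) eq] by auto
  have "\<alpha> = 0" using d(2) x(1) g xg by (simp add: \<alpha>)
  then show "d = 0\<^sub>v l" using \<alpha> x(1) by auto
  show "c i = 0" if "i \<in> {1..m}" using c that by blast
qed

lemma V_mult_orthogonal:
  assumes y: "y \<in> carrier_vec (l - 1)"
  shows "(V *\<^sub>v y) \<bullet>c g = 0"
proof -
  have "(V *\<^sub>v y) \<bullet>c g = (\<Sum>i<l. \<Sum>j<l - 1. y $ j * (V $$ (i, j) * cnj (g $ i)))"
    using V g y by (auto simp: scalar_prod_def sum_distrib_right sum_distrib_left atLeast0LessThan mult_ac intro!: sum.cong)
  also have "\<dots> = (\<Sum>j<l - 1. \<Sum>i<l. y $ j * (V $$ (i, j) * cnj (g $ i)))"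
    by (rule sum.swap)
  also have "\<dots> = (\<Sum>j<l - 1. y $ j * (col V j \<bullet>c g))"
    using V g y by (auto simp: scalar_prod_def sum_distrib_left atLeast0LessThan intro!: sum.cong)
  also have "\<dots> = 0" using Vg by simp
  finally show ?thesis .
qed

text \<open>The bordered map in the coordinates \<open>(c, y)\<close>, where \<open>d = V y\<close>. It is square because
  \<open>m + (l - 1) = k\<close>; the entry \<open>c (Suc r)\<close> at position \<open>r\<close> reflects that coefficients of the pencil are
  counted from \<open>1\<close> and matrix columns from \<open>0\<close>.\<close>
definition bordered_mat :: "complex mat" where
  "bordered_mat = mat k k (\<lambda>(r, c). if c < m then (A (Suc c) *\<^sub>v x) $ r else (P * V) $$ (r, c - m))"

lemma bordered_mat_carrier [simp]: "bordered_mat \<in> carrier_mat k k"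
  and dim_bordered_mat [simp]: "dim_row bordered_mat = k"
  by (simp_all add: bordered_mat_def)

lemma bordered_mat_mult_vec:
  assumes y: "y \<in> carrier_vec (l - 1)"
  shows "bordered_mat *\<^sub>v vec k (\<lambda>r. if r < m then c (Suc r) else y $ (r - m)) = bordered c (V *\<^sub>v y)"
proof (rule eq_vecI)
  fix r assume "r < dim_vec (bordered c (V *\<^sub>v y))"
  then have r: "r < k" by simp
  have split: "sum f {..<a + b} = sum f {..<a} + (\<Sum>j<b. f (a + j))" for f :: "nat \<Rightarrow> complex" and a b
    by (induction b) (auto simp: add.assoc)
  have k: "k = m + (l - 1)" using dims by simp
  have "(bordered_mat *\<^sub>v vec k (\<lambda>r. if r < m then c (Suc r) else y $ (r - m))) $ r =
      (\<Sum>j<k. (if j < m then (A (Suc j) *\<^sub>v x) $ r else (P * V) $$ (r, j - m)) *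
        (if j < m then c (Suc j) else y $ (j - m)))"
    using r by (auto simp: bordered_mat_def scalar_prod_def atLeast0LessThan intro!: sum.cong)
  also have "\<dots> = (\<Sum>j<m. (A (Suc j) *\<^sub>v x) $ r * c (Suc j)) + (\<Sum>j<l - 1. (P * V) $$ (r, j) * y $ j)"
    unfolding k split by simp
  also have "(\<Sum>j<m. (A (Suc j) *\<^sub>v x) $ r * c (Suc j)) = lin_sum k m c (\<lambda>i. A i *\<^sub>v x) $ r"
    using r by (simp add: sum.atLeast1_atMost_eq mult.commute)
  also have "(\<Sum>j<l - 1. (P * V) $$ (r, j) * y $ j) = ((P * V) *\<^sub>v y) $ r"
    using r V y by (auto simp: scalar_prod_def atLeast0LessThan intro!: sum.cong)
  also have "(P * V) *\<^sub>v y = P *\<^sub>v (V *\<^sub>v y)"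
    by (rule assoc_mult_mat_vec[OF pencil_carrier V y])
  finally show "(bordered_mat *\<^sub>v vec k (\<lambda>r. if r < m then c (Suc r) else y $ (r - m))) $ r =
      bordered c (V *\<^sub>v y) $ r"
    using r by simp
qed simp

lemma vec_split:
  assumes z: "z \<in> carrier_vec k"
  obtains c y where "y \<in> carrier_vec (l - 1)"
    "z = vec k (\<lambda>r. if r < m then c (Suc r) else y $ (r - m))"
proof
  show "vec (l - 1) (\<lambda>j. z $ (m + j)) \<in> carrier_vec (l - 1)" by simp
  show "z = vec k (\<lambda>r. if r < m then (\<lambda>i. z $ (i - 1)) (Suc r) else vec (l - 1) (\<lambda>j. z $ (m + j)) $ (r - m))"
    using z dims by (intro eq_vecI) auto
qed

lemma V_injective: "y \<in> carrier_vec (l - 1) \<Longrightarrow> V *\<^sub>v y = 0\<^sub>v l \<Longrightarrow> y = 0\<^sub>v (l - 1)"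
  by (rule vec_space.full_column_rank_injective[OF V rank_V])

lemma bordered_mat_inverse:
  obtains B where "B \<in> carrier_mat k k" "bordered_mat * B = 1\<^sub>m k" "B * bordered_mat = 1\<^sub>m k"
proof (rule injective_square_mat_inverse[OF bordered_mat_carrier])
  fix z assume z: "z \<in> carrier_vec k" "bordered_mat *\<^sub>v z = 0\<^sub>v k"
  obtain c y where y: "y \<in> carrier_vec (l - 1)"
    and z_eq: "z = vec k (\<lambda>r. if r < m then c (Suc r) else y $ (r - m))"
    by (rule vec_split[OF z(1)])
  have Vy: "V *\<^sub>v y \<in> carrier_vec l" using V y by simp
  have eq: "bordered c (V *\<^sub>v y) = 0\<^sub>v k" using z(2) by (simp add: z_eq bordered_mat_mult_vec[OF y])
  have "y = 0\<^sub>v (l - 1)"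
    using V_injective[OF y bordered_injective(1)[OF Vy V_mult_orthogonal[OF y] eq]] .
  moreover have "c i = 0" if "i \<in> {1..m}" for i
    using bordered_injective(2)[OF Vy V_mult_orthogonal[OF y] eq that] .
  ultimately show "z = 0\<^sub>v k"
    unfolding z_eq using dims by (intro eq_vecI) auto
qed (rule that)

lemma bordered_surjective:
  assumes w: "w \<in> carrier_vec k"
  obtains c y where "y \<in> carrier_vec (l - 1)" "bordered c (V *\<^sub>v y) = w"
proof -
  obtain B where B: "B \<in> carrier_mat k k" "bordered_mat * B = 1\<^sub>m k" by (rule bordered_mat_inverse)
  obtain c y where y: "y \<in> carrier_vec (l - 1)"
    and eq: "B *\<^sub>v w = vec k (\<lambda>r. if r < m then c (Suc r) else y $ (r - m))"
    by (rule vec_split[of "B *\<^sub>v w"]) (use B w in auto)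
  have "bordered c (V *\<^sub>v y) = (bordered_mat * B) *\<^sub>v w"
    unfolding assoc_mult_mat_vec[OF bordered_mat_carrier B(1) w] eq bordered_mat_mult_vec[OF y] ..
  then show ?thesis using that[OF y] B w by simp
qed

text \<open>The bordered map is already onto when \<open>d\<close> is restricted to the range of \<open>V\<close>, and it is injective
  on the whole hyperplane, so the two coincide.\<close>
lemma orthogonal_in_range_V:
  assumes d: "d \<in> carrier_vec l" "d \<bullet>c g = 0"
  obtains y where "y \<in> carrier_vec (l - 1)" "d = V *\<^sub>v y"
proof -
  obtain c y where y: "y \<in> carrier_vec (l - 1)" and eq: "bordered c (V *\<^sub>v y) = P *\<^sub>v d"
    by (rule bordered_surjective[of "P *\<^sub>v d"]) (use d in auto)
  have Vy: "V *\<^sub>v y \<in> carrier_vec l" using V y by simp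
  have "bordered c (V *\<^sub>v y - d) = bordered c (V *\<^sub>v y) - P *\<^sub>v d"
    using Vy d by (intro eq_vecI) (auto simp: mult_minus_distrib_mat_vec[OF pencil_carrier Vy d(1)])
  also have "\<dots> = 0\<^sub>v k" unfolding eq using d by auto
  finally have "V *\<^sub>v y - d = 0\<^sub>v l"
    using Vy d g V_mult_orthogonal[OF y]
    by (intro bordered_injective(1)) (auto simp: minus_scalar_prod_distrib[of _ l])
  moreover have "V *\<^sub>v y = d + (V *\<^sub>v y - d)"
    using V Vy d by (intro eq_vecI) auto
  ultimately have "d = V *\<^sub>v y" using d by simp
  then show ?thesis using that y by blast
qed

text \<open>The inverse of \<open>bordered_mat\<close> recovers the eigenvalue perturbation, and its spectral norm serves
  as the constant.\<close>
lemma eigenvalue_perturbation_bound: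
  "\<exists>C\<ge>0. \<forall>c d i. d \<in> carrier_vec l \<longrightarrow> d \<bullet>c g = 0 \<longrightarrow> i \<in> {1..m} \<longrightarrow>
    cmod (c i) \<le> C * vnorm (bordered c d)"
proof -
  obtain B where B: "B \<in> carrier_mat k k" "B * bordered_mat = 1\<^sub>m k" by (rule bordered_mat_inverse)
  have "cmod (c i) \<le> spectral_norm B * vnorm (bordered c d)"
    if d: "d \<in> carrier_vec l" "d \<bullet>c g = 0" and i: "i \<in> {1..m}" for c d i
  proof -
    obtain y where y: "y \<in> carrier_vec (l - 1)" "d = V *\<^sub>v y"
      by (rule orthogonal_in_range_V[OF d])
    define z where "z = vec k (\<lambda>r. if r < m then c (Suc r) else y $ (r - m))"
    have z: "z \<in> carrier_vec k" by (simp add: z_def)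
    have "bordered_mat *\<^sub>v z = bordered c d"
      unfolding z_def bordered_mat_mult_vec[OF y(1)] y(2) ..
    then have "B *\<^sub>v bordered c d = (B * bordered_mat) *\<^sub>v z"
      using assoc_mult_mat_vec[OF B(1) bordered_mat_carrier z] by simp
    then have z_eq: "z = B *\<^sub>v bordered c d" using B z by simp
    have "z $ (i - 1) = c i" using i dims by (auto simp: z_def)
    then have "cmod (c i) \<le> vnorm z" using cmod_index_le_vnorm[of "i - 1" z] z i dims by auto
    also have "\<dots> \<le> spectral_norm B * vnorm (bordered c d)"
      unfolding z_eq by (rule vnorm_mult_mat_vec[OF B(1)]) (use d in auto)
    finally show ?thesis .
  qed
  then show ?thesis by (intro exI[of _ "spectral_norm B"]) simp
qed

lemma adjoint_W_bordered:
  assumes y: "y \<in> carrier_vec (l - 1)"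
  shows "mat_adjoint W *\<^sub>v bordered c (V *\<^sub>v y) = S *\<^sub>v y"
proof -
  have W': "mat_adjoint W \<in> carrier_mat (l - 1) k" using W by simp
  have Ax: "A i *\<^sub>v x \<in> carrier_vec k" if "i \<in> {1..m}" for i
    using A[of i] x(1) that by auto
  have "lin_sum (l - 1) m c (\<lambda>i. mat_adjoint W *\<^sub>v (A i *\<^sub>v x)) = 0\<^sub>v (l - 1)"
    by (intro eq_vecI) (auto simp: WA)
  then have "mat_adjoint W *\<^sub>v lin_sum k m c (\<lambda>i. A i *\<^sub>v x) = 0\<^sub>v (l - 1)"
    using mult_mat_vec_lin_sum[OF W' Ax] by simp
  moreover have "S *\<^sub>v y = mat_adjoint W *\<^sub>v (P *\<^sub>v (V *\<^sub>v y))"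
    unfolding assoc_mult_mat_vec[OF mult_carrier_mat[OF W' pencil_carrier] V y]
    by (rule assoc_mult_mat_vec[OF W' pencil_carrier]) (use V y in auto)
  ultimately show ?thesis
    using W' V y mult_add_distrib_mat_vec[OF W' lin_sum_carrier, of "P *\<^sub>v (V *\<^sub>v y)" m c "\<lambda>i. A i *\<^sub>v x"]
    by (auto intro!: left_zero_vec mult_mat_vec_carrier)
qed

lemma S_carrier: "S \<in> carrier_mat (l - 1) (l - 1)"
  using W V by auto

text \<open>By \<open>adjoint_W_bordered\<close>, a left null vector \<open>v\<^sup>H S = 0\<close> makes \<open>W v\<close> orthogonal to all values of
  the bordered map, that is, to everything; hence \<open>W v = 0\<close>, and \<open>v = 0\<close> by full column rank.\<close>
lemma S_inverse:
  obtains B where "mat_inverse S = Some B" "B \<in> carrier_mat (l - 1) (l - 1)"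
    "S * B = 1\<^sub>m (l - 1)" "B * S = 1\<^sub>m (l - 1)"
proof -
  have "Determinant.det S \<noteq> 0"
  proof
    assume "Determinant.det S = 0"
    then have "Determinant.det (transpose_mat S) = 0" using det_transpose[OF S_carrier] by simp
    then obtain u where u: "u \<in> carrier_vec (l - 1)" "u \<noteq> 0\<^sub>v (l - 1)" "transpose_mat S *\<^sub>v u = 0\<^sub>v (l - 1)"
      using det_0_iff_vec_prod_zero[of "transpose_mat S" "l - 1"] S_carrier by auto
    \<comment> \<open>\<open>u\<close> is a null vector of the transpose, so \<open>conjugate u\<close> is one of the adjoint\<close>
    have cu: "conjugate u \<in> carrier_vec (l - 1)" using u by simp
    have Wu: "W *\<^sub>v conjugate u \<in> carrier_vec k" using W u by simp
    obtain c y where y: "y \<in> carrier_vec (l - 1)" and eq: "bordered c (V *\<^sub>v y) = W *\<^sub>v conjugate u"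
      by (rule bordered_surjective[OF Wu])
    have "(W *\<^sub>v conjugate u) \<bullet>c (W *\<^sub>v conjugate u) = (S *\<^sub>v y) \<bullet>c conjugate u"
      using mat_adjoint_scalar_prod[OF W Wu cu] adjoint_W_bordered[OF y, of c] by (simp add: eq)
    also have "\<dots> = u \<bullet> (S *\<^sub>v y)"
      using S_carrier y u comm_scalar_prod[of "S *\<^sub>v y" "l - 1" u] by simp
    also have "\<dots> = (transpose_mat S *\<^sub>v u) \<bullet> y"
      by (rule transpose_vec_mult_scalar[OF S_carrier y u(1), symmetric])
    also have "\<dots> = 0" using u y by simp
    finally have "W *\<^sub>v conjugate u = 0\<^sub>v k" using conjugate_square_eq_0_vec[OF Wu] by simp
    then have "conjugate u = 0\<^sub>v (l - 1)"
      by (rule vec_space.full_column_rank_injective[OF W rank_W cu])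
    then show False using u(1,2) by (metis conjugate_id conjugate_zero_vec)
  qed
  then have "v = 0\<^sub>v (l - 1)" if "v \<in> carrier_vec (l - 1)" "S *\<^sub>v v = 0\<^sub>v (l - 1)" for v
    using det_0_iff_vec_prod_zero_field[OF S_carrier] that by blast
  then show ?thesis
    by (rule injective_square_mat_inverse[OF S_carrier]) (assumption | rule that)+
qed

lemma invertible_S: "invertible_mat S"
proof -
  obtain B where "B \<in> carrier_mat (l - 1) (l - 1)" "S * B = 1\<^sub>m (l - 1)" "B * S = 1\<^sub>m (l - 1)"
    by (rule S_inverse)
  then show ?thesis
    using V W by (auto simp: invertible_mat_def inverts_mat_def intro!: exI[of _ B])
qed

lemma R_carrier: "R \<in> carrier_mat l k"
proof -
  obtain B where "mat_inverse S = Some B" "B \<in> carrier_mat (l - 1) (l - 1)" by (rule S_inverse)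
  then show ?thesis using V W by (auto intro!: mult_carrier_mat)
qed

lemma R_bordered:
  assumes d: "d \<in> carrier_vec l" "d \<bullet>c g = 0"
  shows "R *\<^sub>v bordered c d = d"
proof -
  obtain B where B: "mat_inverse S = Some B" "B \<in> carrier_mat (l - 1) (l - 1)" "B * S = 1\<^sub>m (l - 1)"
    by (rule S_inverse)
  obtain y where y: "y \<in> carrier_vec (l - 1)" "d = V *\<^sub>v y"
    by (rule orthogonal_in_range_V[OF d])
  have W': "mat_adjoint W \<in> carrier_mat (l - 1) k" using W by simp
  have w: "bordered c d \<in> carrier_vec k" using d by auto
  have "R *\<^sub>v bordered c d = V *\<^sub>v (B *\<^sub>v (mat_adjoint W *\<^sub>v bordered c d))"
    unfolding B(1) option.sel
    using assoc_mult_mat_vec[OF mult_carrier_mat[OF V B(2)] W' w]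
      assoc_mult_mat_vec[OF V B(2), of "mat_adjoint W *\<^sub>v bordered c d"] W' w by simp
  also have "mat_adjoint W *\<^sub>v bordered c d = S *\<^sub>v y"
    unfolding y(2) by (rule adjoint_W_bordered[OF y(1)])
  also have "B *\<^sub>v (S *\<^sub>v y) = (B * S) *\<^sub>v y"
    by (rule assoc_mult_mat_vec[OF B(2) S_carrier y(1), symmetric])
  finally show ?thesis using B y by simp
qed

end

section \<open>Perturbed pencils\<close>

lemma vnorm_eq_of_sum_zero:
  assumes a: "a \<in> carrier_vec n" and b: "b \<in> carrier_vec n" and c: "c \<in> carrier_vec n"
    and eq: "a + b + c = 0\<^sub>v n"
  shows "vnorm a = vnorm (b + c)"
proof -
  have "a = (-1) \<cdot>\<^sub>v (b + c)"
  proof (rule eq_vecI)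
    fix i assume "i < dim_vec ((-1) \<cdot>\<^sub>v (b + c))"
    then have i: "i < n" using c by simp
    have "a $ i + (b $ i + c $ i) = 0"
      using arg_cong[OF eq, of "\<lambda>v. v $ i"] i a b c by (simp add: add.assoc)
    then have "a $ i = - (b $ i + c $ i)" by (simp only: eq_neg_iff_add_eq_0)
    then show "a $ i = ((-1) \<cdot>\<^sub>v (b + c)) $ i"
      using i b c by simp
  qed (use a b c in auto)
  then show ?thesis by (simp add: vnorm_smult)
qed

text \<open>The amplification factor \<open>\<gamma>\<close> of coefficient errors, kept as a function of the point because the
  estimates need it at the perturbed eigenvalue as well.\<close>
definition error_weight :: "nat \<Rightarrow> (nat \<Rightarrow> complex mat) \<Rightarrow> (nat \<Rightarrow> complex) \<Rightarrow> real" where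
  "error_weight m E mu = spectral_norm (E 0) + (\<Sum>i = 1..m. cmod (mu i) * spectral_norm (E i))"

lemma error_weight_nonneg [simp]: "0 \<le> error_weight m E mu"
  by (simp add: error_weight_def sum_nonneg)

lemma error_weight_diff_le:
  assumes "\<And>i. i \<in> {1..m} \<Longrightarrow> cmod (mu i - nu i) \<le> t i"
  shows "error_weight m E mu \<le> error_weight m E nu + (\<Sum>i = 1..m. t i * spectral_norm (E i))"
proof -
  have "cmod (mu i) * spectral_norm (E i) \<le> cmod (nu i) * spectral_norm (E i) + t i * spectral_norm (E i)"
    if "i \<in> {1..m}" for i
  proof -
    have "cmod (mu i) \<le> cmod (nu i) + t i"
      using norm_triangle_sub[of "mu i" "nu i"] assms[OF that] by simp
    then have "cmod (mu i) * spectral_norm (E i) \<le> (cmod (nu i) + t i) * spectral_norm (E i)"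
      by (rule mult_right_mono) simp
    then show ?thesis by (simp only: distrib_right)
  qed
  then have "(\<Sum>i = 1..m. cmod (mu i) * spectral_norm (E i)) \<le>
      (\<Sum>i = 1..m. cmod (nu i) * spectral_norm (E i) + t i * spectral_norm (E i))"
    by (rule sum_mono)
  then show ?thesis
    unfolding error_weight_def sum.distrib by simp
qed

lemma vnorm_pencil_mult_vec:
  assumes D: "\<And>i. i \<le> m \<Longrightarrow> D i \<in> carrier_mat k l"
    and le: "\<And>i. i \<le> m \<Longrightarrow> spectral_norm (D i) \<le> \<epsilon> * spectral_norm (E i)"
    and v: "v \<in> carrier_vec l"
  shows "vnorm (pencil k l m D mu *\<^sub>v v) \<le> \<epsilon> * error_weight m E mu * vnorm v"
proof -
  have Dv: "D i *\<^sub>v v \<in> carrier_vec k" "vnorm (D i *\<^sub>v v) \<le> \<epsilon> * spectral_norm (E i) * vnorm v" if "i \<le> m" for i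
    using D[OF that] v vnorm_mult_mat_vec[OF D[OF that] v] mult_right_mono[OF le[OF that] vnorm_nonneg[of v]]
    by auto
  have "vnorm (pencil k l m D mu *\<^sub>v v) \<le> vnorm (D 0 *\<^sub>v v) + vnorm (lin_sum k m mu (\<lambda>i. D i *\<^sub>v v))"
    unfolding pencil_mult_vec[of m D k l v mu, OF D v, simplified] by (rule vnorm_add[OF Dv(1)]) simp_all
  also have "\<dots> \<le> \<epsilon> * spectral_norm (E 0) * vnorm v +
      (\<Sum>i = 1..m. cmod (mu i) * (\<epsilon> * spectral_norm (E i) * vnorm v))"
  proof (rule add_mono)
    show "vnorm (D 0 *\<^sub>v v) \<le> \<epsilon> * spectral_norm (E 0) * vnorm v" by (rule Dv(2)) simp
    have "vnorm (lin_sum k m mu (\<lambda>i. D i *\<^sub>v v)) \<le> (\<Sum>i = 1..m. cmod (mu i) * vnorm (D i *\<^sub>v v))"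
      by (rule vnorm_lin_sum) (simp add: Dv(1))
    also have "\<dots> \<le> (\<Sum>i = 1..m. cmod (mu i) * (\<epsilon> * spectral_norm (E i) * vnorm v))"
      by (intro sum_mono mult_left_mono Dv(2)) simp_all
    finally show "vnorm (lin_sum k m mu (\<lambda>i. D i *\<^sub>v v)) \<le>
      (\<Sum>i = 1..m. cmod (mu i) * (\<epsilon> * spectral_norm (E i) * vnorm v))" .
  qed
  also have "\<dots> = \<epsilon> * error_weight m E mu * vnorm v"
    by (simp add: error_weight_def distrib_left distrib_right sum_distrib_left sum_distrib_right mult_ac)
  finally show ?thesis .
qed

text \<open>The backward error of an approximate eigenpair. The residual is distributed over the coefficients
  in proportion to \<open>\<parallel>E\<^sub>i\<parallel>\<close>, with phases that turn \<open>\<mu>\<^sub>i\<close> into \<open>\<bar>\<mu>\<^sub>i\<bar>\<close>, so that the contributions add up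
  without cancellation to the full weight; the matrices \<open>r v\<^sup>H\<close> send \<open>v\<close> to a multiple of \<open>r\<close>.\<close>
lemma pencil_backward_error:
  assumes r: "r \<in> carrier_vec k" and v: "v \<in> carrier_vec l" "0 < vnorm v"
    and pos: "0 < error_weight m E mu"
  shows "\<exists>D. (\<forall>i. D i \<in> carrier_mat k l \<and>
      spectral_norm (D i) \<le> vnorm r / (error_weight m E mu * vnorm v) * spectral_norm (E i)) \<and>
    pencil k l m D mu *\<^sub>v v = - r"
proof -
  let ?w = "error_weight m E mu"
  define ph where "ph i = (if i = 0 then 1 else cnj (sgn (mu i)))" for i :: nat
  define q where "q i = - (complex_of_real (spectral_norm (E i)) * ph i) / complex_of_real (?w * (vnorm v)\<^sup>2)" for i
  define D where "D i = rank_one (q i) r v" for i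
  have D: "D i \<in> carrier_mat k l" for i using r v by (simp add: D_def)
  have bound: "spectral_norm (D i) \<le> vnorm r / (?w * vnorm v) * spectral_norm (E i)" for i
  proof -
    have "cmod (ph i) \<le> 1" by (simp add: ph_def norm_sgn)
    then have "cmod (q i) \<le> spectral_norm (E i) / (?w * (vnorm v)\<^sup>2)"
      using pos v(2) by (simp add: q_def norm_divide norm_mult norm_power divide_right_mono mult_left_le)
    then have "cmod (q i) * vnorm r * vnorm v \<le> spectral_norm (E i) / (?w * (vnorm v)\<^sup>2) * vnorm r * vnorm v"
      by (intro mult_right_mono) auto
    also have "\<dots> = vnorm r / (?w * vnorm v) * spectral_norm (E i)"
      using pos v(2) by (simp add: field_simps power2_eq_square)
    finally show ?thesis unfolding D_def by (rule order.trans[OF spectral_norm_rank_one])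
  qed
  have Dv: "D i *\<^sub>v v = (- complex_of_real (spectral_norm (E i)) * ph i / complex_of_real ?w) \<cdot>\<^sub>v r" for i
  proof -
    have "q i * (v \<bullet>c v) = - complex_of_real (spectral_norm (E i)) * ph i / complex_of_real ?w"
      unfolding scalar_prod_self[OF v(1)] using v(2) by (simp add: q_def)
    then show ?thesis unfolding D_def using v(1) by (subst rank_one_mult_vec) auto
  qed
  have ph: "mu i * cnj (sgn (mu i)) = complex_of_real (cmod (mu i))" for i
    by (cases "mu i = 0")
      (simp_all add: sgn_eq complex_norm_square[symmetric] field_simps power2_eq_square)
  have "pencil k l m D mu *\<^sub>v v = - r"
  proof (rule eq_vecI)
    fix i assume "i < dim_vec (- r)"
    then have i: "i < k" using r by simp
    have "(pencil k l m D mu *\<^sub>v v) $ i = (D 0 *\<^sub>v v) $ i + (\<Sum>j = 1..m. mu j * (D j *\<^sub>v v) $ i)"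
      using i carrier_matD[OF D[of 0]] pencil_mult_vec[of m D k l v mu] D v(1) by simp
    also have "\<dots> = - complex_of_real (spectral_norm (E 0)) / complex_of_real ?w * r $ i +
        (\<Sum>j = 1..m. - (mu j * cnj (sgn (mu j))) * complex_of_real (spectral_norm (E j)) / complex_of_real ?w * r $ i)"
      unfolding Dv using i r by (simp add: ph_def mult_ac)
    also have "\<dots> = - ((complex_of_real (spectral_norm (E 0)) +
        (\<Sum>j = 1..m. complex_of_real (cmod (mu j)) * complex_of_real (spectral_norm (E j)))) / complex_of_real ?w * r $ i)"
      unfolding ph by (simp only: add_divide_distrib sum_divide_distrib distrib_right sum_distrib_right
          minus_add_distrib minus_mult_left minus_divide_left sum_negf[symmetric])
    also have "complex_of_real (spectral_norm (E 0)) +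
        (\<Sum>j = 1..m. complex_of_real (cmod (mu j)) * complex_of_real (spectral_norm (E j))) = complex_of_real ?w"
      by (simp add: error_weight_def)
    also have "- (complex_of_real ?w / complex_of_real ?w * r $ i) = (- r) $ i" using i r pos by simp
    finally show "(pencil k l m D mu *\<^sub>v v) $ i = (- r) $ i" .
  qed (use r in auto)
  then show ?thesis using D bound by (intro exI[of _ D] conjI allI)
qed

lemma pencil_add_mult_vec:
  assumes "\<And>i. i \<le> m \<Longrightarrow> A i \<in> carrier_mat k l" "\<And>i. i \<le> m \<Longrightarrow> D i \<in> carrier_mat k l"
    and "v \<in> carrier_vec l"
  shows "pencil k l m (\<lambda>i. A i + D i) mu *\<^sub>v v = pencil k l m A mu *\<^sub>v v + pencil k l m D mu *\<^sub>v v"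
proof -
  have "pencil k l m (\<lambda>i. A i + D i) mu = pencil k l m A mu + pencil k l m D mu"
    using carrier_matD[OF assms(2)]
    by (intro eq_matI) (auto simp: pencil_def distrib_left sum.distrib)
  then show ?thesis by (simp add: add_mult_distrib_mat_vec[OF pencil_carrier pencil_carrier assms(3)])
qed

context bordered_eigenpair
begin

lemma pencil_shift:
  assumes d: "d \<in> carrier_vec l"
  shows "pencil k l m A (\<lambda>i. lam i + c i) *\<^sub>v (x + d) = bordered c d + lin_sum k m c (\<lambda>i. A i *\<^sub>v d)"
proof (rule eq_vecI)
  fix r assume "r < dim_vec (bordered c d + lin_sum k m c (\<lambda>i. A i *\<^sub>v d))"
  then have r: "r < k" by simp
  have Ad: "(A i *\<^sub>v (x + d)) $ r = (A i *\<^sub>v x) $ r + (A i *\<^sub>v d) $ r" if "i \<le> m" for i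
    using r carrier_matD[OF A[OF that]] unfolding mult_add_distrib_mat_vec[OF A[OF that] x(1) d] by simp
  have dim: "dim_row (A 0) = k" using A[of 0] by auto
  have P0: "0 = (A 0 *\<^sub>v x) $ r + (\<Sum>i = 1..m. lam i * (A i *\<^sub>v x) $ r)"
    using arg_cong[OF x(3), of "\<lambda>v. v $ r"] r dim
    by (simp add: pencil_mult_vec[of m A, OF _ x(1)] A del: index_mult_mat_vec)
  have "(pencil k l m A (\<lambda>i. lam i + c i) *\<^sub>v (x + d)) $ r =
      (A 0 *\<^sub>v (x + d)) $ r + (\<Sum>i = 1..m. (lam i + c i) * (A i *\<^sub>v (x + d)) $ r)"
    using r dim
    by (simp add: pencil_mult_vec[of m A, OF _ add_carrier_vec[OF x(1) d]] A del: index_mult_mat_vec)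
  also have "\<dots> = ((A 0 *\<^sub>v x) $ r + (\<Sum>i = 1..m. lam i * (A i *\<^sub>v x) $ r)) +
     ((\<Sum>i = 1..m. c i * (A i *\<^sub>v x) $ r) + ((A 0 *\<^sub>v d) $ r + (\<Sum>i = 1..m. lam i * (A i *\<^sub>v d) $ r)) +
      (\<Sum>i = 1..m. c i * (A i *\<^sub>v d) $ r))"
    using Ad by (simp add: algebra_simps sum.distrib del: index_mult_mat_vec)
  also have "\<dots> = (bordered c d + lin_sum k m c (\<lambda>i. A i *\<^sub>v d)) $ r"
    using r dim unfolding P0[symmetric]
    by (simp add: pencil_mult_vec[of m A, OF _ d] A del: index_mult_mat_vec)
  finally show "(pencil k l m A (\<lambda>i. lam i + c i) *\<^sub>v (x + d)) $ r =
      (bordered c d + lin_sum k m c (\<lambda>i. A i *\<^sub>v d)) $ r" .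
qed simp

lemma bordered_smult:
  assumes "d \<in> carrier_vec l"
  shows "bordered (\<lambda>i. s * c i) (s \<cdot>\<^sub>v d) = s \<cdot>\<^sub>v bordered c d"
  using assms
  by (intro eq_vecI) (auto simp: mult_mat_vec[OF pencil_carrier] sum_distrib_left algebra_simps)

text \<open>The first summand bounds the quadratic remainder of \<open>pencil_shift\<close>, the second one the
  perturbing pencil at the perturbed eigenvector. The bound \<open>t\<close> on the eigenvalue perturbation is left open because the upper
  estimate uses it twice, first with a fixed neighbourhood and then with a multiple of \<open>\<epsilon>\<close>.\<close>
lemma perturbation_residual:
  assumes D: "\<And>i. i \<le> m \<Longrightarrow> D i \<in> carrier_mat k l" and d: "d \<in> carrier_vec l"
    and le: "\<And>i. i \<le> m \<Longrightarrow> spectral_norm (D i) \<le> \<epsilon> * spectral_norm (E i)" and "0 \<le> \<epsilon>"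
    and eq: "pencil k l m (\<lambda>i. A i + D i) (\<lambda>i. lam i + c i) *\<^sub>v (x + d) = 0\<^sub>v k"
    and t: "\<And>i. i \<in> {1..m} \<Longrightarrow> cmod (c i) \<le> t"
  shows "vnorm (bordered c d) \<le> t * (\<Sum>i = 1..m. spectral_norm (A i)) * vnorm d +
    \<epsilon> * (error_weight m E lam + t * (\<Sum>i = 1..m. spectral_norm (E i))) * (vnorm x + vnorm d)"
proof -
  let ?mu = "\<lambda>i. lam i + c i"
  let ?p = "lin_sum k m c (\<lambda>i. A i *\<^sub>v d)" and ?q = "pencil k l m D ?mu *\<^sub>v (x + d)"
  have xd: "x + d \<in> carrier_vec l" using x(1) d by simp
  have Ad: "A i *\<^sub>v d \<in> carrier_vec k" "vnorm (A i *\<^sub>v d) \<le> spectral_norm (A i) * vnorm d" if "i \<le> m" for i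
    using A[OF that] d vnorm_mult_mat_vec[OF A[OF that] d] by auto
  have "bordered c d + ?p + ?q = 0\<^sub>v k"
    using eq pencil_add_mult_vec[of m A k l D "x + d" ?mu] A D xd by (simp add: pencil_shift[OF d])
  then have "vnorm (bordered c d) = vnorm (?p + ?q)"
    by (intro vnorm_eq_of_sum_zero[of _ k]) auto
  also have "\<dots> \<le> vnorm ?p + vnorm ?q" by (rule vnorm_add[of _ k]) auto
  also have "vnorm ?p \<le> (\<Sum>i = 1..m. cmod (c i) * vnorm (A i *\<^sub>v d))"
    using Ad by (intro vnorm_lin_sum) auto
  also have "\<dots> \<le> (\<Sum>i = 1..m. t * (spectral_norm (A i) * vnorm d))"
  proof (rule sum_mono)
    fix i assume i: "i \<in> {1..m}"
    have "0 \<le> t" using order.trans[OF norm_ge_zero t[OF i]] .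
    then show "cmod (c i) * vnorm (A i *\<^sub>v d) \<le> t * (spectral_norm (A i) * vnorm d)"
      using Ad[of i] t[OF i] i by (intro mult_mono) auto
  qed
  also have "\<dots> = t * (\<Sum>i = 1..m. spectral_norm (A i)) * vnorm d"
    by (simp add: sum_distrib_left sum_distrib_right mult_ac)
  also have "vnorm ?q \<le> \<epsilon> * error_weight m E ?mu * vnorm (x + d)"
    by (rule vnorm_pencil_mult_vec[OF D le xd])
  also have "\<dots> \<le> \<epsilon> * (error_weight m E lam + t * (\<Sum>i = 1..m. spectral_norm (E i))) * (vnorm x + vnorm d)"
  proof (intro mult_mono mult_nonneg_nonneg)
    show "error_weight m E ?mu \<le> error_weight m E lam + t * (\<Sum>i = 1..m. spectral_norm (E i))"
      using error_weight_diff_le[of m ?mu lam "\<lambda>_. t" E] t by (simp add: sum_distrib_left)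
    then show "0 \<le> error_weight m E lam + t * (\<Sum>i = 1..m. spectral_norm (E i))"
      by (rule order.trans[OF error_weight_nonneg])
    show "vnorm (x + d) \<le> vnorm x + vnorm d" by (rule vnorm_add[OF x(1) d])
  qed (simp_all add: \<open>0 \<le> \<epsilon>\<close>)
  finally show ?thesis by simp
qed

end

section \<open>The condition number\<close>

context bordered_eigenpair
begin

lemma vnorm_x_pos: "0 < vnorm x"
proof -
  have "vnorm x \<noteq> 0" using vnorm_eq_0[of x] x(1,2) by auto
  then show ?thesis using vnorm_nonneg[of x] by linarith
qed

lemma orthogonal_iff:
  assumes "d \<in> carrier_vec l"
  shows "(x + d) \<bullet>c g = 1 \<longleftrightarrow> d \<bullet>c g = 0"
  using add_scalar_prod_distrib[OF x(1) assms, of "conjugate g"] g xg by simp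

lemma zero_in_eigvec_perturbations:
  assumes "0 < \<delta>" "0 \<le> \<epsilon>"
  shows "0\<^sub>v l \<in> eigvec_perturbations k l m A E g lam x \<delta> \<epsilon>"
proof -
  have "pencil k l m (\<lambda>i. A i + 0\<^sub>m k l) (\<lambda>i. lam i + 0) = P"
    by (intro eq_matI) (auto simp: pencil_def)
  moreover have "spectral_norm (0\<^sub>m k l) \<le> 0"
  proof (rule spectral_norm_le[of _ k l])
    fix v :: "complex vec" assume "v \<in> carrier_vec l"
    then have "0\<^sub>m k l *\<^sub>v v = 0\<^sub>v k" by (intro eq_vecI) auto
    then show "vnorm (0\<^sub>m k l *\<^sub>v v) \<le> 0" by simp
  qed simp
  then have "spectral_norm (0\<^sub>m k l) \<le> \<epsilon> * spectral_norm (E i)" for i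
    by (rule order.trans) (use assms(2) in simp)
  ultimately show ?thesis
    unfolding eigvec_perturbations_def using x xg assms
    by (auto simp: L2_set_def intro!: exI[of _ "\<lambda>_. 0\<^sub>m k l"] exI[of _ "\<lambda>_. 0"])
qed

text \<open>Bootstrapping: the fixed neighbourhood is chosen so small that \<open>R\<close> applied to the quadratic
  remainder is at most \<open>\<parallel>d\<parallel> / 2\<close>, which can be absorbed and yields \<open>\<parallel>d\<parallel> \<le> C1 \<epsilon>\<close>. This makes the
  residual, and with it the eigenvalue perturbation, of order \<open>\<epsilon>\<close>, so that on a second pass the
  remainder is of order \<open>\<epsilon>\<^sup>2\<close> and only \<open>\<parallel>R\<parallel> \<gamma> \<parallel>x\<parallel>\<close> survives in the linear term.\<close>
lemma eigvec_perturbation_upper: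
  "\<exists>\<delta>0>0. \<exists>C\<ge>0. \<forall>\<delta> \<epsilon>. 0 < \<delta> \<longrightarrow> \<delta> \<le> \<delta>0 \<longrightarrow> 0 < \<epsilon> \<longrightarrow> \<epsilon> \<le> 1 \<longrightarrow>
    (\<forall>d \<in> eigvec_perturbations k l m A E g lam x \<delta> \<epsilon>.
      vnorm d \<le> \<epsilon> * (spectral_norm R * error_weight m E lam * vnorm x) + C * \<epsilon>\<^sup>2)"
proof -
  obtain C0 where C0: "0 \<le> C0"
    "\<And>c d i. d \<in> carrier_vec l \<Longrightarrow> d \<bullet>c g = 0 \<Longrightarrow> i \<in> {1..m} \<Longrightarrow> cmod (c i) \<le> C0 * vnorm (bordered c d)"
    using eigenvalue_perturbation_bound by blast
  define \<rho> where "\<rho> = spectral_norm R"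
  define \<gamma> where "\<gamma> = error_weight m E lam"
  define a where "a = (\<Sum>i = 1..m. spectral_norm (A i))"
  define b where "b = (\<Sum>i = 1..m. spectral_norm (E i))"
  define X where "X = vnorm x"
  have nn: "0 \<le> \<rho>" "0 \<le> \<gamma>" "0 \<le> a" "0 \<le> b" "0 \<le> X"
    by (auto simp: \<rho>_def \<gamma>_def a_def b_def X_def sum_nonneg)
  define \<delta>0 where "\<delta>0 = 1 / (2 * (\<rho> * a) + 1)"
  define G where "G = (\<gamma> + b) * (X + 1)"
  define C1 where "C1 = 2 * \<rho> * G"
  define C2 where "C2 = C0 * (a * C1 + G)"
  define C where "C = \<rho> * (C2 * a * C1 + \<gamma> * C1 + C2 * b * (X + C1))"
  have G: "0 \<le> G" and C1: "0 \<le> C1" and C2: "0 \<le> C2"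
    using nn C0(1) by (auto simp: G_def C1_def C2_def)
  have C: "0 \<le> C" using nn C1 C2 by (simp add: C_def)
  have \<delta>0: "0 < \<delta>0" "\<delta>0 \<le> 1" "\<rho> * a * \<delta>0 \<le> 1 / 2"
    using nn by (auto simp: \<delta>0_def field_simps add_pos_nonneg)
  have "vnorm d \<le> \<epsilon> * (\<rho> * \<gamma> * X) + C * \<epsilon>\<^sup>2"
    if \<delta>: "0 < \<delta>" "\<delta> \<le> \<delta>0" and \<epsilon>: "0 < \<epsilon>" "\<epsilon> \<le> 1"
      and d_in: "d \<in> eigvec_perturbations k l m A E g lam x \<delta> \<epsilon>" for \<delta> \<epsilon> d
  proof -
    obtain D c where d: "d \<in> carrier_vec l"
      and D: "\<And>i. i \<le> m \<Longrightarrow> D i \<in> carrier_mat k l" "\<And>i. i \<le> m \<Longrightarrow> spectral_norm (D i) \<le> \<epsilon> * spectral_norm (E i)"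
      and eq: "pencil k l m (\<lambda>i. A i + D i) (\<lambda>i. lam i + c i) *\<^sub>v (x + d) = 0\<^sub>v k"
      and xd: "(x + d) \<bullet>c g = 1"
      and c: "L2_set (\<lambda>i. cmod (c i)) {1..m} < \<delta>" and dd: "vnorm d < \<delta>"
      using d_in unfolding eigvec_perturbations_def by blast
    have dg: "d \<bullet>c g = 0" using xd orthogonal_iff[OF d] by simp
    define r where "r = vnorm (bordered c d)"
    define N where "N = vnorm d"
    have N: "0 \<le> N" "N \<le> 1" using dd \<delta> \<delta>0 by (auto simp: N_def)
    have c_le: "cmod (c i) \<le> \<delta>" if "i \<in> {1..m}" for i
      using member_le_L2_set[of "{1..m}" i "\<lambda>i. cmod (c i)"] that c by simp
    have N_le: "N \<le> \<rho> * r"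
      using vnorm_mult_mat_vec[OF R_carrier, of "bordered c d"] R_bordered[OF d dg, of c]
      by (simp add: N_def \<rho>_def r_def)
    have r_le: "r \<le> t * a * N + \<epsilon> * (\<gamma> + t * b) * (X + N)" if "\<And>i. i \<in> {1..m} \<Longrightarrow> cmod (c i) \<le> t" for t
      unfolding r_def a_def N_def \<gamma>_def b_def X_def
      by (rule perturbation_residual[OF D(1) d D(2) less_imp_le[OF \<epsilon>(1)] eq that])
    \<comment> \<open>first pass, with \<open>t = \<delta>\<close>\<close>
    have r1: "r \<le> \<delta> * a * N + \<epsilon> * G"
    proof -
      have "(\<gamma> + \<delta> * b) * (X + N) \<le> (\<gamma> + b) * (X + 1)"
        using nn \<delta> \<delta>0 N by (intro mult_mono add_mono mult_left_le_one_le) auto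
      then have "\<epsilon> * ((\<gamma> + \<delta> * b) * (X + N)) \<le> \<epsilon> * G"
        unfolding G_def using \<epsilon>(1) by (intro mult_left_mono) auto
      then show ?thesis using r_le[OF c_le] by (simp add: mult.assoc)
    qed
    have N1: "N \<le> C1 * \<epsilon>"
    proof -
      have "\<rho> * a * \<delta> \<le> \<rho> * a * \<delta>0" using nn \<delta> by (intro mult_left_mono) auto
      then have "\<rho> * a * \<delta> * N \<le> 1 / 2 * N"
        using \<delta>0(3) N(1) by (intro mult_right_mono) auto
      moreover have "N \<le> \<rho> * (\<delta> * a * N + \<epsilon> * G)"
        using N_le mult_left_mono[OF r1 nn(1)] by linarith
      ultimately show ?thesis by (simp add: C1_def algebra_simps)
    qed
    have r2: "r \<le> \<epsilon> * (a * C1 + G)"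
    proof -
      have "\<delta> * (a * N) \<le> 1 * (a * (C1 * \<epsilon>))"
        using nn \<delta> \<delta>0 N N1 by (intro mult_mono mult_left_mono) auto
      then show ?thesis using r1 by (simp add: algebra_simps)
    qed
    have c2: "cmod (c i) \<le> C2 * \<epsilon>" if "i \<in> {1..m}" for i
    proof -
      have "cmod (c i) \<le> C0 * r" unfolding r_def by (rule C0(2)[OF d dg that])
      also have "\<dots> \<le> C0 * (\<epsilon> * (a * C1 + G))" by (rule mult_left_mono[OF r2 C0(1)])
      finally show ?thesis by (simp add: C2_def mult_ac)
    qed
    \<comment> \<open>second pass, with \<open>t = C2 * \<epsilon>\<close>\<close>
    have "r \<le> C2 * \<epsilon> * a * N + \<epsilon> * (\<gamma> + C2 * \<epsilon> * b) * (X + N)"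
      by (rule r_le[OF c2])
    also have "\<dots> \<le> C2 * \<epsilon> * a * (C1 * \<epsilon>) + \<epsilon> * (\<gamma> + C2 * \<epsilon> * b) * (X + C1 * \<epsilon>)"
      using nn C2 \<epsilon> N1 by (intro add_mono mult_left_mono) auto
    also have "\<dots> = \<epsilon> * (\<gamma> * X) + (C2 * a * C1 + \<gamma> * C1 + C2 * b * (X + C1 * \<epsilon>)) * \<epsilon>\<^sup>2"
      by (simp add: algebra_simps power2_eq_square)
    also have "\<dots> \<le> \<epsilon> * (\<gamma> * X) + (C2 * a * C1 + \<gamma> * C1 + C2 * b * (X + C1)) * \<epsilon>\<^sup>2"
      using nn C1 C2 \<epsilon> by (intro add_left_mono mult_right_mono mult_left_mono) (auto intro: mult_left_le)
    finally have "\<rho> * r \<le> \<rho> * (\<epsilon> * (\<gamma> * X) + (C2 * a * C1 + \<gamma> * C1 + C2 * b * (X + C1)) * \<epsilon>\<^sup>2)"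
      using nn by (intro mult_left_mono)
    then show ?thesis using N_le by (simp add: N_def C_def algebra_simps)
  qed
  then show ?thesis unfolding \<rho>_def \<gamma>_def X_def using \<delta>0(1) C by blast
qed

text \<open>The perturbed pair is prescribed as \<open>(\<lambda> + s c, x + s d)\<close>, where \<open>(c, d)\<close> solves the linear problem
  for a nearly optimal \<open>w\<close>; the coefficient errors that make it an exact eigenpair are constructed
  afterwards from its residual \<open>s w + s\<^sup>2 \<Sum>\<^sub>i c\<^sub>i A\<^sub>i d\<close>. They are admissible for small \<open>\<epsilon>\<close> because the step
  \<open>s = \<epsilon> \<sigma>\<close> has \<open>\<sigma>\<close> strictly below \<open>\<gamma> \<parallel>x\<parallel>\<close>, which leaves room for the terms of higher order.\<close>
lemma eigvec_perturbation_lower: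
  assumes K: "K < spectral_norm R * error_weight m E lam" and \<delta>: "0 < \<delta>"
  shows "\<forall>\<^sub>F \<epsilon> in at_right 0. \<exists>d \<in> eigvec_perturbations k l m A E g lam x \<delta> \<epsilon>. K * (\<epsilon> * vnorm x) \<le> vnorm d"
proof (cases "K < 0")
  case True
  have "0\<^sub>v l \<in> eigvec_perturbations k l m A E g lam x \<delta> \<epsilon> \<and> K * (\<epsilon> * vnorm x) \<le> vnorm (0\<^sub>v l)"
    if "0 < \<epsilon>" for \<epsilon>
    using zero_in_eigvec_perturbations[OF \<delta>, of \<epsilon> E] that True by (simp add: mult_nonpos_nonneg)
  then show ?thesis
    by (intro eventually_mono[OF eventually_at_right_less]) blast
next
  case False
  define \<gamma> where "\<gamma> = error_weight m E lam"
  have "\<gamma> \<noteq> 0" using K False by (auto simp: \<gamma>_def)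
  then have \<gamma>: "0 < \<gamma>" using error_weight_nonneg[of m E lam] by (simp add: \<gamma>_def less_le)
  have "K / \<gamma> < spectral_norm R" using K \<gamma> by (simp add: \<gamma>_def field_simps)
  then obtain w where w: "w \<in> carrier_vec k" "vnorm w \<le> 1" "K / \<gamma> < vnorm (R *\<^sub>v w)"
    using spectral_norm_less_iff[OF R_carrier] by blast
  obtain c y where y: "y \<in> carrier_vec (l - 1)" and cy: "bordered c (V *\<^sub>v y) = w"
    by (rule bordered_surjective[OF w(1)])
  define d where "d = V *\<^sub>v y"
  have d: "d \<in> carrier_vec l" "d \<bullet>c g = 0" and cd: "bordered c d = w"
    using V y cy V_mult_orthogonal[OF y] by (auto simp: d_def)
  have Rw: "R *\<^sub>v w = d" using R_bordered[OF d, of c] by (simp add: cd)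
  have Kd: "K < \<gamma> * vnorm d" using w(3) \<gamma> by (simp add: Rw field_simps)
  have nd: "0 < vnorm d"
  proof (rule ccontr)
    assume "\<not> 0 < vnorm d"
    moreover have "0 \<le> K / \<gamma>" using False \<gamma> by simp
    ultimately show False using w(3) unfolding Rw by linarith
  qed
  \<comment> \<open>chosen such that the step \<open>\<epsilon> \<sigma>\<close> along \<open>d\<close> has relative length exactly \<open>K \<epsilon>\<close>\<close>
  define \<sigma> where "\<sigma> = K * vnorm x / vnorm d"
  have \<sigma>: "0 \<le> \<sigma>" "\<sigma> < \<gamma> * vnorm x"
    using False Kd nd vnorm_x_pos by (auto simp: \<sigma>_def field_simps)
  define q where "q = vnorm (lin_sum k m c (\<lambda>i. A i *\<^sub>v d))"
  define b where "b = (\<Sum>i = 1..m. cmod (c i) * spectral_norm (E i))"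
  have "((\<lambda>\<epsilon>. \<gamma> - \<epsilon> * \<sigma> * b) \<longlongrightarrow> \<gamma> - 0 * \<sigma> * b) (at_right 0)"
    by (intro tendsto_intros)
  then have ev1: "\<forall>\<^sub>F \<epsilon> in at_right 0. 0 < \<gamma> - \<epsilon> * \<sigma> * b"
    by (rule order_tendstoD) (use \<gamma> in simp)
  have "((\<lambda>\<epsilon>. vnorm x - \<epsilon> * \<sigma> * vnorm d) \<longlongrightarrow> vnorm x - 0 * \<sigma> * vnorm d) (at_right 0)"
    by (intro tendsto_intros)
  then have ev2: "\<forall>\<^sub>F \<epsilon> in at_right 0. 0 < vnorm x - \<epsilon> * \<sigma> * vnorm d"
    by (rule order_tendstoD) (use vnorm_x_pos in simp)
  have "((\<lambda>\<epsilon>. (\<gamma> - \<epsilon> * \<sigma> * b) * (vnorm x - \<epsilon> * \<sigma> * vnorm d) - (\<sigma> + \<epsilon> * \<sigma>\<^sup>2 * q)) \<longlongrightarrow>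
      (\<gamma> - 0 * \<sigma> * b) * (vnorm x - 0 * \<sigma> * vnorm d) - (\<sigma> + 0 * \<sigma>\<^sup>2 * q)) (at_right 0)"
    by (intro tendsto_intros)
  then have ev3: "\<forall>\<^sub>F \<epsilon> in at_right 0.
      0 < (\<gamma> - \<epsilon> * \<sigma> * b) * (vnorm x - \<epsilon> * \<sigma> * vnorm d) - (\<sigma> + \<epsilon> * \<sigma>\<^sup>2 * q)"
    by (rule order_tendstoD) (use \<sigma> in simp)
  have "((\<lambda>\<epsilon>. \<epsilon> * \<sigma> * L2_set (\<lambda>i. cmod (c i)) {1..m}) \<longlongrightarrow> 0 * \<sigma> * L2_set (\<lambda>i. cmod (c i)) {1..m}) (at_right 0)"
    by (intro tendsto_intros)
  then have ev4: "\<forall>\<^sub>F \<epsilon> in at_right 0. \<epsilon> * \<sigma> * L2_set (\<lambda>i. cmod (c i)) {1..m} < \<delta>"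
    by (rule order_tendstoD) (use \<delta> in simp)
  have "((\<lambda>\<epsilon>. \<epsilon> * \<sigma> * vnorm d) \<longlongrightarrow> 0 * \<sigma> * vnorm d) (at_right 0)"
    by (intro tendsto_intros)
  then have ev5: "\<forall>\<^sub>F \<epsilon> in at_right 0. \<epsilon> * \<sigma> * vnorm d < \<delta>"
    by (rule order_tendstoD) (use \<delta> in simp)
  show ?thesis
    using ev1 ev2 ev3 ev4 ev5 eventually_at_right_less[of "0 :: real"]
  proof eventually_elim
    case (elim \<epsilon>)
    define s where "s = \<epsilon> * \<sigma>"
    have s: "0 \<le> s" using elim(6) \<sigma> by (simp add: s_def)
    define dx where "dx = complex_of_real s \<cdot>\<^sub>v d"
    define dlam where "dlam i = complex_of_real s * c i" for i
    define mu where "mu i = lam i + dlam i" for i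
    have dx: "dx \<in> carrier_vec l" "dx \<bullet>c g = 0" using d g by (auto simp: dx_def)
    have ndx: "vnorm dx = s * vnorm d" using s by (simp add: dx_def vnorm_smult)
    have xdx: "x + dx \<in> carrier_vec l" using x(1) dx by simp
    have nx: "vnorm x - s * vnorm d \<le> vnorm (x + dx)"
    proof -
      have "x = (x + dx) + (-1) \<cdot>\<^sub>v dx" using x(1) dx by (intro eq_vecI) auto
      then have "vnorm x \<le> vnorm (x + dx) + vnorm ((-1) \<cdot>\<^sub>v dx)"
        using vnorm_add[OF xdx, of "(-1) \<cdot>\<^sub>v dx"] dx by simp
      then show ?thesis by (simp add: vnorm_smult ndx)
    qed
    have wt: "\<gamma> - s * b \<le> error_weight m E mu"
    proof -
      have "error_weight m E lam \<le> error_weight m E mu + (\<Sum>i = 1..m. s * cmod (c i) * spectral_norm (E i))"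
        using s by (intro error_weight_diff_le) (auto simp: mu_def dlam_def norm_mult)
      then show ?thesis by (simp add: \<gamma>_def b_def sum_distrib_left mult.assoc)
    qed
    define r where "r = pencil k l m A mu *\<^sub>v (x + dx)"
    have r: "r \<in> carrier_vec k" by (simp add: r_def)
    have linear: "bordered dlam dx = complex_of_real s \<cdot>\<^sub>v w"
      unfolding dx_def dlam_def[abs_def] cd[symmetric] by (rule bordered_smult[OF d(1)])
    have quadratic: "lin_sum k m dlam (\<lambda>i. A i *\<^sub>v dx) = complex_of_real (s\<^sup>2) \<cdot>\<^sub>v lin_sum k m c (\<lambda>i. A i *\<^sub>v d)"
      using d A by (intro eq_vecI)
        (auto simp: dlam_def dx_def mult_mat_vec[OF A d(1)] sum_distrib_left power2_eq_square mult_ac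
          carrier_matD[OF A] simp del: index_mult_mat_vec intro!: sum.cong)
    have "r = complex_of_real s \<cdot>\<^sub>v w + complex_of_real (s\<^sup>2) \<cdot>\<^sub>v lin_sum k m c (\<lambda>i. A i *\<^sub>v d)"
      unfolding r_def mu_def[abs_def] pencil_shift[OF dx(1), of dlam] linear quadratic ..
    then have "vnorm r \<le> s * vnorm w + s\<^sup>2 * q"
      using vnorm_add[of "complex_of_real s \<cdot>\<^sub>v w" k "complex_of_real (s\<^sup>2) \<cdot>\<^sub>v lin_sum k m c (\<lambda>i. A i *\<^sub>v d)"] w(1) s
      by (simp add: vnorm_smult q_def norm_power)
    also have "\<dots> \<le> s + s\<^sup>2 * q" using s w(2) by (simp add: mult_left_le)
    also have "\<dots> = \<epsilon> * (\<sigma> + \<epsilon> * \<sigma>\<^sup>2 * q)" by (simp add: s_def power2_eq_square algebra_simps)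
    also have "\<dots> \<le> \<epsilon> * ((\<gamma> - s * b) * (vnorm x - s * vnorm d))"
      using elim(3,6) by (intro mult_left_mono) (auto simp: s_def)
    also have "\<dots> \<le> \<epsilon> * (error_weight m E mu * vnorm (x + dx))"
      using elim(1,2,6) wt nx by (intro mult_left_mono mult_mono) (auto simp: s_def)
    finally have r_le: "vnorm r \<le> \<epsilon> * (error_weight m E mu * vnorm (x + dx))" .
    have pos: "0 < error_weight m E mu" "0 < vnorm (x + dx)"
      using elim(1,2) wt nx by (auto simp: s_def)
    obtain D where D: "\<And>i. D i \<in> carrier_mat k l"
      "\<And>i. spectral_norm (D i) \<le> vnorm r / (error_weight m E mu * vnorm (x + dx)) * spectral_norm (E i)"
      "pencil k l m D mu *\<^sub>v (x + dx) = - r"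
      using pencil_backward_error[OF r xdx pos(2,1)] by blast
    have "vnorm r / (error_weight m E mu * vnorm (x + dx)) \<le> \<epsilon>"
      using r_le pos by (simp add: pos_divide_le_eq)
    then have "spectral_norm (D i) \<le> \<epsilon> * spectral_norm (E i)" for i
      by (rule order.trans[OF D(2) mult_right_mono[OF _ spectral_norm_nonneg]])
    moreover have "pencil k l m (\<lambda>i. A i + D i) mu *\<^sub>v (x + dx) = 0\<^sub>v k"
      using pencil_add_mult_vec[of m A k l D "x + dx" mu] A D(1,3) xdx r by (simp add: r_def[symmetric])
    moreover have "L2_set (\<lambda>i. cmod (dlam i)) {1..m} = s * L2_set (\<lambda>i. cmod (c i)) {1..m}"
      using s by (simp add: dlam_def norm_mult L2_set_right_distrib)
    ultimately have "dx \<in> eigvec_perturbations k l m A E g lam x \<delta> \<epsilon>"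
      unfolding eigvec_perturbations_def
      using D(1) dx(1) xg orthogonal_iff[OF dx(1)] dx(2) elim(4,5) ndx
      by (auto simp: mu_def[abs_def] s_def intro!: exI[of _ D] exI[of _ dlam])
    moreover have "K * (\<epsilon> * vnorm x) \<le> vnorm dx"
      unfolding ndx s_def \<sigma>_def using nd by simp
    ultimately show ?case by blast
  qed
qed

lemma eigvec_condition_number:
  "has_eigvec_condition_number k l m A E g lam x (spectral_norm R * error_weight m E lam)"
proof -
  let ?K = "spectral_norm R * error_weight m E lam"
  let ?S = "\<lambda>\<delta> \<epsilon>. eigvec_perturbations k l m A E g lam x \<delta> \<epsilon>"
  obtain \<delta>0 C where \<delta>0: "0 < \<delta>0" "0 \<le> C"
    and upper: "\<And>\<delta> \<epsilon> d. \<lbrakk>0 < \<delta>; \<delta> \<le> \<delta>0; 0 < \<epsilon>; \<epsilon> \<le> 1; d \<in> ?S \<delta> \<epsilon>\<rbrakk> \<Longrightarrow>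
      vnorm d \<le> \<epsilon> * (?K * vnorm x) + C * \<epsilon>\<^sup>2"
    using eigvec_perturbation_upper[of E] by blast
  have "((\<lambda>\<epsilon>. SUP d \<in> ?S \<delta> \<epsilon>. vnorm d / (\<epsilon> * vnorm x)) \<longlongrightarrow> ?K) (at_right 0)"
    if \<delta>: "0 < \<delta>" "\<delta> < \<delta>0" for \<delta>
  proof (rule order_tendstoI)
    fix K assume "K < ?K"
    then obtain K' where K': "K < K'" "K' < ?K" using dense by blast
    show "\<forall>\<^sub>F \<epsilon> in at_right 0. K < (SUP d \<in> ?S \<delta> \<epsilon>. vnorm d / (\<epsilon> * vnorm x))"
      using eigvec_perturbation_lower[OF K'(2) \<delta>(1)] eventually_at_right_less[of "0 :: real"]
    proof eventually_elim
      case (elim \<epsilon>)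
      then obtain d where d: "d \<in> ?S \<delta> \<epsilon>" "K' * (\<epsilon> * vnorm x) \<le> vnorm d" by blast
      have pos: "0 < \<epsilon> * vnorm x" using elim(2) vnorm_x_pos by simp
      have bdd: "bdd_above ((\<lambda>d. vnorm d / (\<epsilon> * vnorm x)) ` ?S \<delta> \<epsilon>)"
        using pos by (intro bdd_aboveI2[of _ _ "\<delta> / (\<epsilon> * vnorm x)"] divide_right_mono)
          (auto simp: eigvec_perturbations_def)
      have "K' \<le> vnorm d / (\<epsilon> * vnorm x)" using d(2) pos by (simp add: pos_le_divide_eq)
      also have "\<dots> \<le> (SUP d \<in> ?S \<delta> \<epsilon>. vnorm d / (\<epsilon> * vnorm x))" by (rule cSUP_upper[OF d(1) bdd])
      finally show ?case using K'(1) by simp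
    qed
  next
    fix K assume K: "?K < K"
    have "((\<lambda>\<epsilon>. ?K + C / vnorm x * \<epsilon>) \<longlongrightarrow> ?K + C / vnorm x * 0) (at_right 0)"
      by (intro tendsto_intros)
    then have "\<forall>\<^sub>F \<epsilon> in at_right 0. ?K + C / vnorm x * \<epsilon> < K"
      by (rule order_tendstoD) (use K in simp)
    then show "\<forall>\<^sub>F \<epsilon> in at_right 0. (SUP d \<in> ?S \<delta> \<epsilon>. vnorm d / (\<epsilon> * vnorm x)) < K"
      using eventually_at_right_real[of 0 1, simplified]
    proof eventually_elim
      case (elim \<epsilon>)
      then have \<epsilon>: "0 < \<epsilon>" "\<epsilon> \<le> 1" by auto
      have "(SUP d \<in> ?S \<delta> \<epsilon>. vnorm d / (\<epsilon> * vnorm x)) \<le> ?K + C / vnorm x * \<epsilon>"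
      proof (rule cSUP_least)
        show "?S \<delta> \<epsilon> \<noteq> {}" using zero_in_eigvec_perturbations[OF \<delta>(1), of \<epsilon> E] \<epsilon> by auto
        fix d assume "d \<in> ?S \<delta> \<epsilon>"
        then have "vnorm d \<le> \<epsilon> * (?K * vnorm x) + C * \<epsilon>\<^sup>2"
          using upper \<delta> \<epsilon> by simp
        also have "\<dots> = (?K + C / vnorm x * \<epsilon>) * (\<epsilon> * vnorm x)"
          using vnorm_x_pos by (simp add: field_simps power2_eq_square)
        finally show "vnorm d / (\<epsilon> * vnorm x) \<le> ?K + C / vnorm x * \<epsilon>"
          using \<epsilon> vnorm_x_pos by (simp add: pos_divide_le_eq)
      qed
      then show ?case using elim(1) by simp
    qed
  qed
  then show ?thesis
    unfolding has_eigvec_condition_number_def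
    using eventually_at_right_real[OF \<delta>0(1)] by (auto elim!: eventually_mono)
qed

end

theorem mainTheorem4:
  fixes k l m :: nat and A E :: "nat \<Rightarrow> complex mat"
    and lam :: "nat \<Rightarrow> complex" and x g :: "complex vec" and V W :: "complex mat"
  assumes "rect_mep k l m A"
    and "eigenpair k l m A lam x"
    and "algebraically_simple k l m A lam"
    and "\<And>i. i \<le> m \<Longrightarrow> E i \<in> carrier_mat k l"
    and "g \<in> carrier_vec l" and "x \<bullet>c g = 1"
    and "V \<in> carrier_mat l (l - 1)" and "vec_space.rank l V = l - 1"
    and "W \<in> carrier_mat k (l - 1)" and "vec_space.rank k W = l - 1"
    and "\<And>j. j < l - 1 \<Longrightarrow> col V j \<bullet>c g = 0"
    and "\<And>i. i \<in> {1..m} \<Longrightarrow> mat_adjoint W *\<^sub>v (A i *\<^sub>v x) = 0\<^sub>v (l - 1)"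
  shows "invertible_mat (mat_adjoint W * pencil k l m A lam * V) \<and>
    has_eigvec_condition_number k l m A E g lam x
      (spectral_norm (V * the (mat_inverse (mat_adjoint W * pencil k l m A lam * V)) * mat_adjoint W)
        * (spectral_norm (E 0) + (\<Sum>i = 1..m. cmod (lam i) * spectral_norm (E i))))"
proof -
  interpret bordered_eigenpair k l m A lam x g V W
    using assms by unfold_locales (auto simp: rect_mep_def)
  show ?thesis
    using invertible_S eigvec_condition_number[of E] by (simp add: error_weight_def)
qed

end
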